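(* Assume $0\notin\Gamma_\mu$, let $s\in I_\mu^\circ\setminus\{0\}$, and assume either (i) $s<0$ and there is $\varkappa_0>1$ such that for $\mu$-a.e. $g$: $g>0$ and $\max_{i,j}g^{i,j}\le\varkappa_0\min_{i,j}g^{i,j}$; or (ii) $s>0$ and there is $\varkappa>1$ such that for $\mu$-a.e. $g$: $g>0$ and $\max_ig^{i,j}\le\varkappa\min_ig^{i,j}$ for all $1\le j\le d$. Then, for any $0<\gamma\le\min\{|s|,1\}$, $f\in\mathcal S$ and $n\ge1$, $$Q_{s,f}^n=\Pi_{s,f}+N_{s,f}^n,$$ where, for $\varphi\in\mathscr B_\gamma$ (as functions on $\mathcal S_\epsilon$) and $v\in\mathcal S_\epsilon$, $$\Pi_{s,f}\varphi(v)=\pi_{s,f}(\varphi),\qquad N_{s,f}^n\varphi(v)=\frac1{\kappa(s)^nr_{s,f}(v)}L_{s,f}^n(\varphi r_{s,f})(v),$$ and $\Pi_{s,f}N_{s,f}=N_{s,f}\Pi_{s,f}=0$. In addition, there exist constants $c_s>0$ and $a\in(0,1)$ such that for all $f\in\mathcal S$ and $n\ge1$, $$\|N_{s,f}^n\|_{\mathscr B_\gamma\to\mathscr B_\gamma}\le c_sa^n.$$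
   Context: Let $d\ge2$. $\mathbb R^d$ carries the standard scalar product and the norm $\|v\|=\sum_i|v_i|$; $\mathbb R^d_+$ is the set of vectors with non-negative coordinates; $\mathcal S=\{v\in\mathbb R^d_+:\|v\|=1\}$; $\mathcal S_\epsilon=\{v\in\mathcal S:\langle f,v\rangle\ge\epsilon\ \forall f\in\mathcal S\}$. $\mathbb G$ is the semigroup of non-negative $d\times d$ matrices, $\|g\|=\sum_{i,j}g^{i,j}$, $g>0$ means all entries strictly positive, $g^{\mathrm T}$ the transpose, $g\cdot v=gv/\|gv\|$. $(g_n)$ are i.i.d. in $\mathbb G$ with law $\mu$, $G_n=g_n\cdots g_1$; $\Gamma_\mu$ is the closed semigroup spanned by $\operatorname{supp}\mu$. Throughout, $\epsilon\in(0,1)$ is a fixed constant such that $g\cdot\mathcal S\subseteq\mathcal S_\epsilon$ for all $g\in\operatorname{supp}\mu$, and in case (i) also $g^{\mathrm T}\cdot\mathcal S\subseteq\mathcal S_\epsilon$ (such $\epsilon$ exists under the hypotheses). $I_\mu=\{s\in\mathbb R:\mathbb E\|g_1\|^s<\infty\}$ with interior $I_\mu^\circ$. $\kappa(s)=\lim_n(\mathbb E\|G_n\|^s)^{1/n}$. $P_s\varphi(v)=\int\|gv\|^s\varphi(g\cdot v)\mu(dg)$, $P_s^*\varphi(v)=\int\|g^{\mathrm T}v\|^s\varphi(g^{\mathrm T}\cdot v)\mu(dg)$, and on measures $(P_s\eta)\varphi=\eta(P_s\varphi)$ (likewise $P_s^*$). Under the hypotheses there are unique probability measures $\nu_s,\nu_s^*$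 on $\mathcal S$ with $P_s\nu_s=\kappa(s)\nu_s$, $P_s^*\nu_s^*=\kappa(s)\nu_s^*$ (and $\operatorname{supp}\nu_s\subseteq\mathcal S_\epsilon$), and $r_s(v)=\int\langle v,u\rangle^s\nu_s^*(du)$ is strictly positive, continuous and satisfies $P_sr_s=\kappa(s)r_s$. For $f\in\mathcal S$ and $v\in\mathcal S_\epsilon$: $P_{s,f}\varphi(v)=\int_{\mathbb G}\frac{\langle f,gv\rangle^s}{\langle f,v\rangle^s}\varphi(g\cdot v)\mu(dg)$, $r_{s,f}(v)=\langle f,v\rangle^{-s}r_s(v)$, $\nu_{s,f}(\varphi)=\nu_s(\langle f,\cdot\rangle^s\varphi)/\nu_s(r_s)$, and $L_{s,f}=P_{s,f}-\kappa(s)M_{s,f}$ with $M_{s,f}\varphi=\nu_{s,f}(\varphi)r_{s,f}$ (so $P_{s,f}^n=\kappa(s)^nM_{s,f}+L_{s,f}^n$). The Markov operator $Q_{s,f}$ is $Q_{s,f}\varphi(v)=\frac1{\kappa(s)r_{s,f}(v)}P_{s,f}(\varphi r_{s,f})(v)$, $v\in\mathcal S_\epsilon$, and $\pi_{s,f}(\varphi)=\nu_{s,f}(\varphi r_{s,f})$. The space $\mathcal S$ is equipped with the Hilbert cross-ratio metric $\mathbf d(u,v)=\frac{1-m(u,v)m(v,u)}{1+m(u,v)m(v,u)}$, $m(u,v)=\sup\{\lambda\ge0:\lambda v_i\le u_i\ \forall i\}$. $\mathscr B_\gamma$ is the Banach space of complex-valued continuous $\varphi$ with $\|\varphi\|_\gamma=\sup|\varphi|+\sup_{u\ne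 v}|\varphi(u)-\varphi(v)|/\mathbf d(u,v)^\gamma<\infty$; here functions are considered on $\mathcal S_\epsilon$. $\|\cdot\|_{\mathscr B_\gamma\to\mathscr B_\gamma}$ is the operator norm. *)

theory Defs
  imports "HOL-Probability.Probability"
begin

text \<open>
  Vectors of $R^d$ have type \<^typ>\<open>real ^ 'n\<close>, with $d$ the cardinality of \<^typ>\<open>'n\<close>; the entry
  $g^{i,j}$ (row $i$, column $j$) is \<open>g $ i $ j\<close>.
\<close>

definition l1norm :: "real ^ 'n \<Rightarrow> real" where
  "l1norm v = (\<Sum>i\<in>UNIV. \<bar>v $ i\<bar>)"

definition SS :: "(real ^ 'n) set" where
  "SS = {v. (\<forall>i. 0 \<le> v $ i) \<and> l1norm v = 1}"

definition SSeps :: "real \<Rightarrow> (real ^ 'n) set" where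
  "SSeps \<epsilon> = {v \<in> SS. \<forall>f\<in>SS. f \<bullet> v \<ge> \<epsilon>}"

definition GG :: "(real ^ 'n ^ 'n) set" where
  "GG = {g. \<forall>i j. 0 \<le> g $ i $ j}"

definition pos_mat :: "real ^ 'n ^ 'n \<Rightarrow> bool" where
  "pos_mat g \<longleftrightarrow> (\<forall>i j. 0 < g $ i $ j)"

definition mnorm :: "real ^ 'n ^ 'n \<Rightarrow> real" where
  "mnorm g = (\<Sum>i\<in>UNIV. \<Sum>j\<in>UNIV. g $ i $ j)"

text \<open>The projective action $g \cdot v$ is meaningful only if \<open>g *v v \<noteq> 0\<close>.\<close>

definition act :: "real ^ 'n ^ 'n \<Rightarrow> real ^ 'n \<Rightarrow> real ^ 'n" where
  "act g v = (1 / l1norm (g *v v)) *\<^sub>R (g *v v)"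

definition prob_on :: "'a::topological_space set \<Rightarrow> 'a measure \<Rightarrow> bool" where
  "prob_on X M \<longleftrightarrow> prob_space M \<and> sets M = sets (restrict_space borel X)"

definition msupp :: "'a::topological_space measure \<Rightarrow> 'a set" where
  "msupp M = {x \<in> space M. \<forall>U. open U \<longrightarrow> x \<in> U \<longrightarrow> 0 < emeasure M (U \<inter> space M)}"

definition Gamma_mu :: "(real ^ 'n ^ 'n) measure \<Rightarrow> (real ^ 'n ^ 'n) set" where
  "Gamma_mu \<mu> = (\<lambda>T. closed T \<and> (\<forall>g\<in>T. \<forall>h\<in>T. g ** h \<in> T)) hull msupp \<mu>"

text \<open>
  As \<open>0 powr s = 0\<close>, the next two definitions agree with the convention $0^s = \infty$ for $s < 0$
  only when the matrices (products) in question are almost surely nonzero. This holds whenever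
  $\mu$-almost every matrix has strictly positive entries.
\<close>

definition I_mu :: "(real ^ 'n ^ 'n) measure \<Rightarrow> real set" where
  "I_mu \<mu> = {s. integrable \<mu> (\<lambda>g. mnorm g powr s)}"

text \<open>$G_n = g_n \cdots g_1$; the i.i.d. sequence is the coordinate process of the infinite product
  of \<open>\<mu>\<close> (coordinate 0 is unused).\<close>

primrec Gprod :: "(nat \<Rightarrow> real ^ 'n ^ 'n) \<Rightarrow> nat \<Rightarrow> real ^ 'n ^ 'n" where
  "Gprod g 0 = mat 1"
| "Gprod g (Suc n) = g (Suc n) ** Gprod g n"

definition kappa :: "(real ^ 'n ^ 'n) measure \<Rightarrow> real \<Rightarrow> real" where
  "kappa \<mu> s =
     lim (\<lambda>n. root n (LINT g|(\<Pi>\<^sub>M i\<in>(UNIV :: nat set). \<mu>). mnorm (Gprod g n) powr s))"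

definition Ps :: "(real ^ 'n ^ 'n) measure \<Rightarrow> real \<Rightarrow> (real ^ 'n \<Rightarrow> complex) \<Rightarrow> real ^ 'n \<Rightarrow> complex" where
  "Ps \<mu> s \<phi> v = (LINT g|\<mu>. (l1norm (g *v v) powr s) *\<^sub>R \<phi> (act g v))"

definition Ps_star :: "(real ^ 'n ^ 'n) measure \<Rightarrow> real \<Rightarrow> (real ^ 'n \<Rightarrow> complex) \<Rightarrow> real ^ 'n \<Rightarrow> complex" where
  "Ps_star \<mu> s \<phi> v =
     (LINT g|\<mu>. (l1norm (transpose g *v v) powr s) *\<^sub>R \<phi> (act (transpose g) v))"

text \<open>The equality $T \eta = k \eta$ of measures on \<^const>\<open>SS\<close>, where $(T\eta)\varphi = \eta(T\varphi)$
  for continuous $\varphi$.\<close>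

definition eigenmeasure ::
    "((real ^ 'n \<Rightarrow> complex) \<Rightarrow> real ^ 'n \<Rightarrow> complex) \<Rightarrow> real \<Rightarrow> (real ^ 'n) measure \<Rightarrow> bool" where
  "eigenmeasure T k \<eta> \<longleftrightarrow>
     (\<forall>\<phi>. continuous_on SS \<phi> \<longrightarrow> (LINT v|\<eta>. T \<phi> v) = k *\<^sub>R (LINT v|\<eta>. \<phi> v))"

definition rs :: "(real ^ 'n) measure \<Rightarrow> real \<Rightarrow> real ^ 'n \<Rightarrow> real" where
  "rs \<nu>' s v = (LINT u|\<nu>'. (v \<bullet> u) powr s)"

text \<open>
  From here on a function on \<^term>\<open>SSeps \<epsilon>\<close> is represented by a total function whose values outside
  \<^term>\<open>SSeps \<epsilon>\<close> are irrelevant. The integrals below are therefore restricted to arguments of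
  \<open>\<phi>\<close> lying in \<^term>\<open>SSeps \<epsilon>\<close>; under the standing assumption on \<open>\<epsilon>\<close> this drops null sets
  only. In the names, \<open>\<nu>\<close> is $\nu_s$ and \<open>\<nu>'\<close> is $\nu_s^*$.
\<close>

definition Psf :: "(real ^ 'n ^ 'n) measure \<Rightarrow> real \<Rightarrow> real \<Rightarrow> real ^ 'n \<Rightarrow>
    (real ^ 'n \<Rightarrow> complex) \<Rightarrow> real ^ 'n \<Rightarrow> complex" where
  "Psf \<mu> \<epsilon> s f \<phi> v =
     (LINT g:{g. act g v \<in> SSeps \<epsilon>}|\<mu>.
        ((f \<bullet> (g *v v)) powr s / (f \<bullet> v) powr s) *\<^sub>R \<phi> (act g v))"

definition rsf :: "(real ^ 'n) measure \<Rightarrow> real \<Rightarrow> real ^ 'n \<Rightarrow> real ^ 'n \<Rightarrow> real" where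
  "rsf \<nu>' s f v = (f \<bullet> v) powr (- s) * rs \<nu>' s v"

definition nusf :: "(real ^ 'n) measure \<Rightarrow> (real ^ 'n) measure \<Rightarrow> real \<Rightarrow> real \<Rightarrow> real ^ 'n \<Rightarrow>
    (real ^ 'n \<Rightarrow> complex) \<Rightarrow> complex" where
  "nusf \<nu> \<nu>' \<epsilon> s f \<phi> =
     (LINT v:SSeps \<epsilon>|\<nu>. ((f \<bullet> v) powr s) *\<^sub>R \<phi> v) /\<^sub>R (LINT v|\<nu>. rs \<nu>' s v)"

definition Msf :: "(real ^ 'n) measure \<Rightarrow> (real ^ 'n) measure \<Rightarrow> real \<Rightarrow> real \<Rightarrow> real ^ 'n \<Rightarrow>
    (real ^ 'n \<Rightarrow> complex) \<Rightarrow> real ^ 'n \<Rightarrow> complex" where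
  "Msf \<nu> \<nu>' \<epsilon> s f \<phi> v = rsf \<nu>' s f v *\<^sub>R nusf \<nu> \<nu>' \<epsilon> s f \<phi>"

definition Lsf :: "(real ^ 'n ^ 'n) measure \<Rightarrow> (real ^ 'n) measure \<Rightarrow> (real ^ 'n) measure \<Rightarrow>
    real \<Rightarrow> real \<Rightarrow> real ^ 'n \<Rightarrow> (real ^ 'n \<Rightarrow> complex) \<Rightarrow> real ^ 'n \<Rightarrow> complex" where
  "Lsf \<mu> \<nu> \<nu>' \<epsilon> s f \<phi> v = Psf \<mu> \<epsilon> s f \<phi> v - kappa \<mu> s *\<^sub>R Msf \<nu> \<nu>' \<epsilon> s f \<phi> v"

definition Qsf :: "(real ^ 'n ^ 'n) measure \<Rightarrow> (real ^ 'n) measure \<Rightarrow>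
    real \<Rightarrow> real \<Rightarrow> real ^ 'n \<Rightarrow> (real ^ 'n \<Rightarrow> complex) \<Rightarrow> real ^ 'n \<Rightarrow> complex" where
  "Qsf \<mu> \<nu>' \<epsilon> s f \<phi> v =
     (1 / (kappa \<mu> s * rsf \<nu>' s f v)) *\<^sub>R Psf \<mu> \<epsilon> s f (\<lambda>u. rsf \<nu>' s f u *\<^sub>R \<phi> u) v"

definition pisf :: "(real ^ 'n) measure \<Rightarrow> (real ^ 'n) measure \<Rightarrow> real \<Rightarrow> real \<Rightarrow> real ^ 'n \<Rightarrow>
    (real ^ 'n \<Rightarrow> complex) \<Rightarrow> complex" where
  "pisf \<nu> \<nu>' \<epsilon> s f \<phi> = nusf \<nu> \<nu>' \<epsilon> s f (\<lambda>u. rsf \<nu>' s f u *\<^sub>R \<phi> u)"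

definition Pisf :: "(real ^ 'n) measure \<Rightarrow> (real ^ 'n) measure \<Rightarrow> real \<Rightarrow> real \<Rightarrow> real ^ 'n \<Rightarrow>
    (real ^ 'n \<Rightarrow> complex) \<Rightarrow> real ^ 'n \<Rightarrow> complex" where
  "Pisf \<nu> \<nu>' \<epsilon> s f \<phi> v = pisf \<nu> \<nu>' \<epsilon> s f \<phi>"

text \<open>The operator $N_{s,f}$ itself; its powers are ordinary iterates.\<close>

definition Nsf :: "(real ^ 'n ^ 'n) measure \<Rightarrow> (real ^ 'n) measure \<Rightarrow> (real ^ 'n) measure \<Rightarrow>
    real \<Rightarrow> real \<Rightarrow> real ^ 'n \<Rightarrow> (real ^ 'n \<Rightarrow> complex) \<Rightarrow> real ^ 'n \<Rightarrow> complex" where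
  "Nsf \<mu> \<nu> \<nu>' \<epsilon> s f \<phi> v =
     (1 / (kappa \<mu> s * rsf \<nu>' s f v)) *\<^sub>R Lsf \<mu> \<nu> \<nu>' \<epsilon> s f (\<lambda>u. rsf \<nu>' s f u *\<^sub>R \<phi> u) v"

definition mcr :: "real ^ 'n \<Rightarrow> real ^ 'n \<Rightarrow> real" where
  "mcr u v = Sup {l. 0 \<le> l \<and> (\<forall>i. l * v $ i \<le> u $ i)}"

definition hdist :: "real ^ 'n \<Rightarrow> real ^ 'n \<Rightarrow> real" where
  "hdist u v = (1 - mcr u v * mcr v u) / (1 + mcr u v * mcr v u)"

text \<open>The norm of $\mathscr B_\gamma$ over \<^term>\<open>SSeps \<epsilon>\<close>, with value \<open>\<infinity>\<close> allowed.\<close>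

definition Bnorm :: "real \<Rightarrow> real \<Rightarrow> (real ^ 'n \<Rightarrow> complex) \<Rightarrow> ennreal" where
  "Bnorm \<epsilon> \<gamma> \<phi> = (SUP v\<in>SSeps \<epsilon>. ennreal (cmod (\<phi> v))) +
     (SUP (u, v)\<in>{(u, v). u \<in> SSeps \<epsilon> \<and> v \<in> SSeps \<epsilon> \<and> u \<noteq> v}.
        ennreal (cmod (\<phi> u - \<phi> v) / hdist u v powr \<gamma>))"

definition Bspace :: "real \<Rightarrow> real \<Rightarrow> (real ^ 'n \<Rightarrow> complex) set" where
  "Bspace \<epsilon> \<gamma> = {\<phi>. continuous_on (SSeps \<epsilon>) \<phi> \<and> Bnorm \<epsilon> \<gamma> \<phi> < \<infinity>}"

definition Bopnorm :: "real \<Rightarrow> real \<Rightarrow>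
    ((real ^ 'n \<Rightarrow> complex) \<Rightarrow> real ^ 'n \<Rightarrow> complex) \<Rightarrow> ennreal" where
  "Bopnorm \<epsilon> \<gamma> T = (SUP \<phi>\<in>{\<phi> \<in> Bspace \<epsilon> \<gamma>. Bnorm \<epsilon> \<gamma> \<phi> \<le> 1}. Bnorm \<epsilon> \<gamma> (T \<phi>))"

end

theory Submission
  imports Defs
begin

text \<open>
  The factors involving \<open>f\<close> cancel, so on \<^term>\<open>SSeps \<epsilon>\<close> both $Q_{s,f}$ and $\pi_{s,f}$ are independent
  of \<open>f\<close>: with $R(w) = \int \langle w,u\rangle^s \nu_s^*(du)$, which is homogeneous of degree $s$,
  $Q\varphi(v) = \frac{1}{\kappa(s) R(v)} \int R(gv) \varphi(g \cdot v) \mu(dg)$. The eigenvalue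
  equation for $\nu_s^*$ says that $Q$ is Markov, the one for $\nu_s$ that $\nu_s$ is carried by
  \<^term>\<open>SSeps \<epsilon>\<close> and that $R \nu_s$ is, up to normalisation, stationary. Hence $N = Q - \Pi$.

  For the decay, let $\rho(u,v) = \max_i (u_i/v_i) / \min_i (u_i/v_i) - 1$. Every $g$ contracts
  $\rho$ by $1 - \epsilon$, and the densities of $Q$ at $u$ and $v$ have a ratio of at least
  $(1+\rho(u,v))^{-|s|}$. Coupling two chains by using the same $g$ as often as these
  densities allow gives a Doeblin-Fortet inequality for the $\rho^\gamma$-seminorm and, since $\rho$ is
  bounded, a lower bound for the probability that the chains use the same matrix $n$ times in a row. Together they make
  $\mathrm{osc} + \theta \, |\cdot|_\gamma$ contract under some power of $Q$.
\<close>

section \<open>Markov operators of contracting random maps\<close>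

text \<open>Everything is measured modulo constants: oscillation and Hoelder seminorm vanish on
  constants, and \<open>Q\<close> fixes them. The stationary mean lies within one oscillation of
  every value, so decay of these two numbers is all that is needed. Neither estimate suffices alone.
  The Doeblin-Fortet inequality always returns a fixed multiple of the oscillation, so it never
  makes the seminorm small; the coupling bound shrinks the oscillation only when the seminorm is not
  too large against it. The ratio \<rho> suits both estimates: a comparison m v \<le> u \<le> M v
  survives every non-negative matrix and every integration, and its effect on functions homogeneous
  of degree s is controlled by powers of m and M. On \<open>SSeps \<epsilon>\<close> it is
  equivalent to the cross-ratio distance. One obstacle is that the eigenvalue equations may be
  tested only with functions continuous on all of \<open>SS\<close>, while elements of the function
  space are known on \<open>SSeps \<epsilon>\<close> alone.\<close>

lemma weighted_average_bound:
  fixes h :: "'a \<Rightarrow> 'b::{banach, second_countable_topology}"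
  assumes w: "integrable M w" "AE x in M. 0 \<le> w x"
    and wh: "integrable M (\<lambda>x. w x *\<^sub>R h x)"
    and A: "AE x in M. norm (h x - z) \<le> A"
  shows "norm ((LINT x|M. w x *\<^sub>R h x) - (LINT x|M. w x) *\<^sub>R z) \<le> A * (LINT x|M. w x)"
proof -
  have "(LINT x|M. w x *\<^sub>R h x) - (LINT x|M. w x) *\<^sub>R z = (LINT x|M. w x *\<^sub>R (h x - z))"
    using w wh by (simp add: scaleR_diff_right)
  also have "norm \<dots> \<le> (LINT x|M. w x * A)"
  proof (rule order_trans[OF integral_norm_bound integral_mono_AE])
    show "AE x in M. norm (w x *\<^sub>R (h x - z)) \<le> w x * A"
      using w(2) A by eventually_elim (auto intro: mult_left_mono)
  qed (use w wh in \<open>auto simp: scaleR_diff_right\<close>)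
  finally show ?thesis by (simp add: mult.commute)
qed

text \<open>Upper bounds in place of suprema: no finiteness has to be proved, and both bounds can be
  propagated through \<open>Q\<close> together.\<close>

definition osc_holder :: "'x set \<Rightarrow> ('x \<Rightarrow> 'x \<Rightarrow> real) \<Rightarrow> real \<Rightarrow> ('x \<Rightarrow> complex) \<Rightarrow> real \<Rightarrow> real \<Rightarrow> bool" where
  "osc_holder X \<rho> \<gamma> \<phi> A B \<longleftrightarrow>
    (\<forall>u\<in>X. \<forall>v\<in>X. cmod (\<phi> u - \<phi> v) \<le> A \<and> cmod (\<phi> u - \<phi> v) \<le> B * \<rho> u v powr \<gamma>)"

lemma osc_holder_osc: "osc_holder X \<rho> \<gamma> \<phi> A B \<Longrightarrow> u \<in> X \<Longrightarrow> v \<in> X \<Longrightarrow> cmod (\<phi> u - \<phi> v) \<le> A"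
  and osc_holder_holder: "osc_holder X \<rho> \<gamma> \<phi> A B \<Longrightarrow> u \<in> X \<Longrightarrow> v \<in> X \<Longrightarrow> cmod (\<phi> u - \<phi> v) \<le> B * \<rho> u v powr \<gamma>"
  by (auto simp: osc_holder_def)

lemma osc_holder_mono:
  assumes "osc_holder X \<rho> \<gamma> \<phi> A B" "A \<le> A'" "B \<le> B'"
  shows "osc_holder X \<rho> \<gamma> \<phi> A' B'"
  unfolding osc_holder_def
proof (intro ballI conjI)
  fix u v assume uv: "u \<in> X" "v \<in> X"
  show "cmod (\<phi> u - \<phi> v) \<le> A'" using osc_holder_osc[OF assms(1) uv] assms(2) by simp
  have "B * \<rho> u v powr \<gamma> \<le> B' * \<rho> u v powr \<gamma>" using assms(3) by (intro mult_right_mono) auto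
  then show "cmod (\<phi> u - \<phi> v) \<le> B' * \<rho> u v powr \<gamma>" using osc_holder_holder[OF assms(1) uv] by simp
qed

text \<open>This makes the mass on which two coupled chains part linear in their distance, as the
  Doeblin-Fortet inequality requires.\<close>

lemma one_minus_powr_le: "1 - (1 + r) powr (- \<sigma>) \<le> \<sigma> * r" if "0 \<le> r" "0 \<le> \<sigma>" for r \<sigma> :: real
proof -
  have "1 - \<sigma> * ln (1 + r) \<le> exp (- \<sigma> * ln (1 + r))"
    using exp_ge_add_one_self[of "- \<sigma> * ln (1 + r)"] by simp
  moreover have "\<sigma> * ln (1 + r) \<le> \<sigma> * r" using ln_add_one_self_le_self[of r] that by (simp add: mult_left_mono)
  ultimately show ?thesis using that by (simp add: powr_def)
qed

text \<open>\<open>q v\<close> is the density of the random map \<open>T g\<close> applied at \<open>v\<close>. Only the values of a function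
  on \<open>X\<close> matter to the operator \<open>Q\<close> below.\<close>

locale contracting_kernel =
  fixes M :: "'g measure" and X :: "'x set" and T :: "'g \<Rightarrow> 'x \<Rightarrow> 'x" and q :: "'x \<Rightarrow> 'g \<Rightarrow> real"
    and \<rho> :: "'x \<Rightarrow> 'x \<Rightarrow> real" and \<tau> \<sigma> D \<gamma> :: real
  assumes tau: "0 < \<tau>" "\<tau> < 1" and sigma: "0 < \<sigma>" and D: "1 \<le> D" and gamma: "0 < \<gamma>" "\<gamma> \<le> 1"
    and rho_nonneg: "\<And>u v. u \<in> X \<Longrightarrow> v \<in> X \<Longrightarrow> 0 \<le> \<rho> u v"
    and rho_le: "\<And>u v. u \<in> X \<Longrightarrow> v \<in> X \<Longrightarrow> \<rho> u v \<le> D"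
    and q_integrable: "\<And>v. v \<in> X \<Longrightarrow> integrable M (q v)"
    and q_mass: "\<And>v. v \<in> X \<Longrightarrow> (LINT g|M. q v g) = 1"
    and q_nonneg: "\<And>v. v \<in> X \<Longrightarrow> AE g in M. 0 \<le> q v g"
    and T_in: "\<And>v. v \<in> X \<Longrightarrow> AE g in M. T g v \<in> X"
    and T_contract: "\<And>u v. u \<in> X \<Longrightarrow> v \<in> X \<Longrightarrow> AE g in M. \<rho> (T g u) (T g v) \<le> \<tau> * \<rho> u v"
    and q_compare: "\<And>u v. u \<in> X \<Longrightarrow> v \<in> X \<Longrightarrow> AE g in M. (1 + \<rho> u v) powr (- \<sigma>) * q v g \<le> q u g"
    and measurable: "\<And>\<phi> A B v. osc_holder X \<rho> \<gamma> \<phi> A B \<Longrightarrow> v \<in> X \<Longrightarrow>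
          (\<lambda>g. indicator X (T g v) *\<^sub>R \<phi> (T g v)) \<in> borel_measurable M"
begin

definition Q :: "('x \<Rightarrow> complex) \<Rightarrow> 'x \<Rightarrow> complex" where
  "Q \<phi> v = (LINT g|M. q v g *\<^sub>R (indicator X (T g v) *\<^sub>R \<phi> (T g v)))"

lemma Q_integrable:
  assumes "osc_holder X \<rho> \<gamma> \<phi> A B" "v \<in> X"
  shows "integrable M (\<lambda>g. q v g *\<^sub>R (indicator X (T g v) *\<^sub>R \<phi> (T g v)))"
proof (rule Bochner_Integration.integrable_bound)
  show "integrable M (\<lambda>g. q v g * (cmod (\<phi> v) + A))" using q_integrable[OF assms(2)] by simp
  show "(\<lambda>g. q v g *\<^sub>R (indicator X (T g v) *\<^sub>R \<phi> (T g v))) \<in> borel_measurable M"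
    using q_integrable[OF assms(2)] by (intro borel_measurable_scaleR measurable[OF assms]) auto
  show "AE g in M. norm (q v g *\<^sub>R (indicator X (T g v) *\<^sub>R \<phi> (T g v))) \<le> norm (q v g * (cmod (\<phi> v) + A))"
    using q_nonneg[OF assms(2)] T_in[OF assms(2)]
  proof eventually_elim
    case (elim g)
    have "cmod (\<phi> (T g v)) \<le> cmod (\<phi> v) + cmod (\<phi> (T g v) - \<phi> v)" by (metis add.commute diff_add_cancel norm_triangle_ineq)
    also have "cmod (\<phi> (T g v) - \<phi> v) \<le> A" using osc_holder_osc[OF assms(1) elim(2) assms(2)] .
    finally have "cmod (\<phi> (T g v)) \<le> \<bar>cmod (\<phi> v) + A\<bar>" by simp
    then show ?case using elim by (auto simp: abs_mult intro!: mult_left_mono)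
  qed
qed

lemma Q_diff_const:
  assumes "osc_holder X \<rho> \<gamma> \<phi> A B" "v \<in> X"
  shows "Q (\<lambda>u. \<phi> u - c) v = Q \<phi> v - c"
proof -
  have c: "osc_holder X \<rho> \<gamma> (\<lambda>_. c) 0 0" by (simp add: osc_holder_def)
  have "Q (\<lambda>u. \<phi> u - c) v = Q \<phi> v - Q (\<lambda>_. c) v"
    using Q_integrable[OF assms] Q_integrable[OF c assms(2)] by (simp add: Q_def scaleR_diff_right)
  also have "Q (\<lambda>_. c) v = (LINT g|M. q v g *\<^sub>R c)"
    unfolding Q_def using T_in[OF assms(2)] Q_integrable[OF c assms(2)] q_integrable[OF assms(2)]
    by (intro integral_cong_AE borel_measurable_integrable) (auto elim!: eventually_mono)
  also have "\<dots> = c" using q_integrable[OF assms(2)] q_mass[OF assms(2)] by simp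
  finally show ?thesis .
qed

text \<open>A coupling estimate: with probability \<open>p\<close> the two chains use the same map.\<close>

lemma Q_coupling:
  assumes \<phi>: "osc_holder X \<rho> \<gamma> \<phi> A B" and u: "u \<in> X" and v: "v \<in> X" and p: "0 \<le> p" "p \<le> 1"
    and pq: "AE g in M. p * q v g \<le> q u g"
    and W: "AE g in M. cmod (\<phi> (T g u) - \<phi> (T g v)) \<le> W"
  shows "cmod (Q \<phi> u - Q \<phi> v) \<le> p * W + (1 - p) * A"
proof -
  define h where "h w g = indicator X (T g w) *\<^sub>R \<phi> (T g w)" for w g
  have iu: "integrable M (\<lambda>g. q u g *\<^sub>R h u g)" and iv: "integrable M (\<lambda>g. q v g *\<^sub>R h v g)"
    using Q_integrable[OF \<phi> u] Q_integrable[OF \<phi> v] by (simp_all add: h_def)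
  have hX: "AE g in M. h w g = \<phi> (T g w) \<and> T g w \<in> X" if "w \<in> X" for w
    using T_in[OF that] by eventually_elim (simp add: h_def)
  have ivu: "integrable M (\<lambda>g. q v g *\<^sub>R h u g)"
  proof (rule Bochner_Integration.integrable_bound)
    show "integrable M (\<lambda>g. q v g * (cmod (\<phi> v) + A))" using q_integrable[OF v] by simp
    show "(\<lambda>g. q v g *\<^sub>R h u g) \<in> borel_measurable M"
      using q_integrable[OF v] measurable[OF \<phi> u] unfolding h_def by (intro borel_measurable_scaleR[where f = "q v"]) auto
    show "AE g in M. norm (q v g *\<^sub>R h u g) \<le> norm (q v g * (cmod (\<phi> v) + A))"
      using q_nonneg[OF v] hX[OF u]
    proof eventually_elim
      case (elim g)
      then have e: "T g u \<in> X" by simp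
      have "cmod (\<phi> (T g u)) \<le> cmod (\<phi> v) + cmod (\<phi> (T g u) - \<phi> v)" by (metis add.commute diff_add_cancel norm_triangle_ineq)
      also have "cmod (\<phi> (T g u) - \<phi> v) \<le> A" using osc_holder_osc[OF \<phi> e v] .
      finally have "cmod (\<phi> (T g u)) \<le> \<bar>cmod (\<phi> v) + A\<bar>" by simp
      then show ?case using elim by (auto simp: abs_mult intro!: mult_left_mono)
    qed
  qed
  \<comment> \<open>What remains of the density at \<open>u\<close> once the shared part
    \<open>p * q v\<close> is removed; its mass is \<open>1 - p\<close>.\<close>
  define \<alpha> where "\<alpha> = (\<lambda>g. q u g - p * q v g)"
  have \<alpha>: "integrable M \<alpha>" "AE g in M. 0 \<le> \<alpha> g" "(LINT g|M. \<alpha> g) = 1 - p"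
      "integrable M (\<lambda>g. \<alpha> g *\<^sub>R h u g)"
    using q_integrable[OF u] q_integrable[OF v] q_mass[OF u] q_mass[OF v] pq iu ivu
    by (auto simp: \<alpha>_def scaleR_diff_left simp flip: scaleR_scaleR)
  define I where "I = (LINT g|M. \<alpha> g *\<^sub>R h u g)"
  have I: "cmod (I - (1 - p) *\<^sub>R \<phi> y) \<le> A * (1 - p)" if "y \<in> X" for y
    unfolding I_def \<alpha>(3)[symmetric]
  proof (rule weighted_average_bound[OF \<alpha>(1,2,4)])
    show "AE g in M. norm (h u g - \<phi> y) \<le> A"
      using hX[OF u] by eventually_elim (use osc_holder_osc[OF \<phi> _ that] in auto)
  qed
  \<comment> \<open>Two averages over \<open>X\<close> differ by at most the oscillation: the
    leftover law is compared with each point value, and then the point is averaged under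
    \<open>q v\<close>. The normalised mean \<open>E\<close> exists only for \<open>p\<close> other
    than 1.\<close>
  have 1: "cmod (I - (1 - p) *\<^sub>R Q \<phi> v) \<le> (1 - p) * A"
  proof (cases "p = 1")
    case True then show ?thesis using I[OF v] by simp
  next
    case False
    then have p1: "0 < 1 - p" using p by simp
    define E where "E = I /\<^sub>R (1 - p)"
    have "cmod (\<phi> y - E) \<le> A" if "y \<in> X" for y
    proof -
      have "I - (1 - p) *\<^sub>R \<phi> y = (1 - p) *\<^sub>R (E - \<phi> y)" using p1 by (simp add: E_def scaleR_diff_right)
      then have "(1 - p) * cmod (E - \<phi> y) \<le> (1 - p) * A" using I[OF that] p1 by (simp add: mult.commute)
      then show ?thesis using p1 by (simp add: norm_minus_commute)
    qed
    then have "AE g in M. cmod (h v g - E) \<le> A" using AE_mp[OF hX[OF v] AE_I2] by simp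
    from weighted_average_bound[OF q_integrable[OF v] q_nonneg[OF v] iv this]
    have "cmod (Q \<phi> v - E) \<le> A" using q_mass[OF v] by (simp add: Q_def h_def)
    moreover have "I - (1 - p) *\<^sub>R Q \<phi> v = (1 - p) *\<^sub>R (E - Q \<phi> v)" using p1 by (simp add: E_def scaleR_diff_right)
    ultimately show ?thesis using p1 by (simp add: norm_minus_commute mult_left_mono)
  qed
  have "AE g in M. cmod ((h u g - h v g) - 0) \<le> W" using W hX[OF u] hX[OF v] by eventually_elim auto
  from weighted_average_bound[OF q_integrable[OF v] q_nonneg[OF v] _ this]
  have 2: "cmod (LINT g|M. q v g *\<^sub>R (h u g - h v g)) \<le> W"
    using q_mass[OF v] iv ivu by (simp add: scaleR_diff_right)
  \<comment> \<open>The leftover mass is compared with an equal share of the second chain; on the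
    shared mass both chains use the same \<open>g\<close>.\<close>
  have "Q \<phi> u - Q \<phi> v = (I - (1 - p) *\<^sub>R Q \<phi> v) + p *\<^sub>R (LINT g|M. q v g *\<^sub>R (h u g - h v g))"
    using iu iv ivu by (simp add: I_def \<alpha>_def Q_def h_def[symmetric] scaleR_diff_left scaleR_diff_right
        flip: scaleR_scaleR)
  then have "cmod (Q \<phi> u - Q \<phi> v) \<le> (1 - p) * A + cmod (p *\<^sub>R (LINT g|M. q v g *\<^sub>R (h u g - h v g)))"
    using 1 norm_triangle_ineq[of "I - (1 - p) *\<^sub>R Q \<phi> v"] by (smt (verit))
  also have "\<dots> \<le> (1 - p) * A + p * W" using 2 p by (simp add: mult_left_mono)
  finally show ?thesis by simp
qed

text \<open>Since \<open>\<rho>\<close> is at most \<open>D\<close>, any two chains can share their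
  next map with at least this probability.\<close>

definition cpl :: real where "cpl = (1 + D) powr (- \<sigma>)"

lemma cpl: "0 < cpl" "cpl < 1"
  using D sigma by (auto simp: cpl_def powr_less_one)

text \<open>The coupling is used twice. Sharing nothing (\<open>p = 0\<close>) shows that the
  oscillation does not grow. Sharing as much as \<open>q_compare\<close> permits gives the
  Doeblin-Fortet inequality: the shared part gains \<open>\<tau> powr \<gamma>\<close>, the rest
  costs the oscillation times \<open>1 - p\<close>, which is at most
  \<open>\<sigma> * \<rho> u v\<close>.\<close>

lemma Q_osc_holder:
  assumes \<phi>: "osc_holder X \<rho> \<gamma> \<phi> A B" and B: "0 \<le> B"
  shows "osc_holder X \<rho> \<gamma> (Q \<phi>) A (\<tau> powr \<gamma> * B + \<sigma> * D * A)"
  unfolding osc_holder_def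
proof (intro ballI conjI)
  fix u v assume uv: "u \<in> X" "v \<in> X"
  have A: "0 \<le> A" using osc_holder_osc[OF \<phi> uv(1) uv(1)] by simp
  show "cmod (Q \<phi> u - Q \<phi> v) \<le> A"
  proof -
    have "AE g in M. cmod (\<phi> (T g u) - \<phi> (T g v)) \<le> A"
      using T_in[OF uv(1)] T_in[OF uv(2)] by eventually_elim (use osc_holder_osc[OF \<phi>] in auto)
    from Q_coupling[OF \<phi> uv _ _ _ this, of 0] show ?thesis using q_nonneg[OF uv(1)] by simp
  qed
  let ?p = "(1 + \<rho> u v) powr (- \<sigma>)"
  have p: "0 \<le> ?p" "?p \<le> 1" "1 - ?p \<le> \<sigma> * \<rho> u v"
    using rho_nonneg[OF uv] sigma one_minus_powr_le[of "\<rho> u v" \<sigma>] by (auto simp: powr_mono2' powr_minus inverse_le_1_iff ge_one_powr_ge_zero)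
  have W: "AE g in M. cmod (\<phi> (T g u) - \<phi> (T g v)) \<le> B * (\<tau> powr \<gamma> * \<rho> u v powr \<gamma>)"
    using T_in[OF uv(1)] T_in[OF uv(2)] T_contract[OF uv]
  proof eventually_elim
    case (elim g)
    have "\<rho> (T g u) (T g v) powr \<gamma> \<le> (\<tau> * \<rho> u v) powr \<gamma>"
      using rho_nonneg elim gamma by (intro powr_mono2) auto
    then have "B * \<rho> (T g u) (T g v) powr \<gamma> \<le> B * (\<tau> powr \<gamma> * \<rho> u v powr \<gamma>)"
      using B tau rho_nonneg[OF uv] by (simp add: powr_mult mult_left_mono)
    then show ?case using osc_holder_holder[OF \<phi> elim(1,2)] by linarith
  qed
  \<comment> \<open>The lost mass is linear in \<open>\<rho>\<close>, but the seminorm asks for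
    \<open>\<rho> powr \<gamma>\<close>. As \<open>\<gamma> \<le> 1\<close>, the spare factor
    \<open>\<rho> powr (1 - \<gamma>)\<close> is at most \<open>D\<close>.\<close>
  have r: "\<rho> u v \<le> D * \<rho> u v powr \<gamma>"
  proof (cases "\<rho> u v = 0")
    case False
    then have pos: "0 < \<rho> u v" using rho_nonneg[OF uv] by simp
    have "\<rho> u v = \<rho> u v powr (1 - \<gamma>) * \<rho> u v powr \<gamma>" using pos by (simp flip: powr_add)
    also have "\<rho> u v powr (1 - \<gamma>) \<le> D powr (1 - \<gamma>)" using pos rho_le[OF uv] gamma by (intro powr_mono2) auto
    also have "D powr (1 - \<gamma>) \<le> D powr 1" using D gamma by (intro powr_mono) auto
    finally show ?thesis using D by (simp add: mult_right_mono)
  qed (use D in auto)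
  have "cmod (Q \<phi> u - Q \<phi> v) \<le> ?p * (B * (\<tau> powr \<gamma> * \<rho> u v powr \<gamma>)) + (1 - ?p) * A"
    by (rule Q_coupling[OF \<phi> uv p(1,2) q_compare[OF uv] W])
  also have "\<dots> \<le> 1 * (B * (\<tau> powr \<gamma> * \<rho> u v powr \<gamma>)) + (\<sigma> * \<rho> u v) * A"
    using p A B by (intro add_mono mult_right_mono) auto
  also have "(\<sigma> * \<rho> u v) * A \<le> (\<sigma> * (D * \<rho> u v powr \<gamma>)) * A"
    using r sigma A by (intro mult_right_mono mult_left_mono) auto
  finally show "cmod (Q \<phi> u - Q \<phi> v) \<le> (\<tau> powr \<gamma> * B + \<sigma> * D * A) * \<rho> u v powr \<gamma>"
    by (simp add: algebra_simps)
qed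

text \<open>The sum over \<open>k\<close> of
  \<open>\<sigma> * D * (\<tau> powr \<gamma>) ^ k\<close>, hence the fixed point in
  \<open>LY_eq\<close>: the multiple of the oscillation that stays in the seminorm bound under all
  iterates.\<close>

definition LY :: real where "LY = \<sigma> * D / (1 - \<tau> powr \<gamma>)"

lemma tau_gamma: "0 < \<tau> powr \<gamma>" "\<tau> powr \<gamma> < 1"
  using tau gamma powr_less_mono2[of \<gamma> \<tau> 1] by auto

lemma LY_pos: "0 < LY" and LY_eq: "\<tau> powr \<gamma> * LY + \<sigma> * D = LY"
  using tau_gamma sigma D by (auto simp: LY_def field_simps)

lemma Q_funpow_osc_holder:
  assumes \<phi>: "osc_holder X \<rho> \<gamma> \<phi> A B" and AB: "0 \<le> A" "0 \<le> B"
  shows "osc_holder X \<rho> \<gamma> ((Q ^^ n) \<phi>) A ((\<tau> powr \<gamma>) ^ n * B + LY * A)"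
proof (induction n)
  case 0
  show ?case using osc_holder_mono[OF \<phi>, of A "B + LY * A"] LY_pos AB by simp
next
  case (Suc n)
  have "0 \<le> (\<tau> powr \<gamma>) ^ n * B + LY * A" using AB LY_pos by simp
  note Q_osc_holder[OF Suc this]
  moreover have "\<tau> powr \<gamma> * ((\<tau> powr \<gamma>) ^ n * B + LY * A) + \<sigma> * D * A
      = (\<tau> powr \<gamma>) ^ Suc n * B + (\<tau> powr \<gamma> * LY + \<sigma> * D) * A"
    by (simp add: algebra_simps)
  ultimately show ?case by (simp add: LY_eq)
qed

text \<open>The first map is shared with weight \<open>cpl\<close>; the induction hypothesis treats
  the remaining ones, started at the images, whose distance is at most
  \<open>\<tau> * \<rho> u v\<close>. Where the sharing breaks off, only the oscillation of the
  current iterate counts, and that is still at most \<open>A\<close>.\<close>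

lemma Q_funpow_doeblin:
  assumes \<phi>: "osc_holder X \<rho> \<gamma> \<phi> A B" and AB: "0 \<le> A" "0 \<le> B" and uv: "u \<in> X" "v \<in> X"
  shows "cmod ((Q ^^ n) \<phi> u - (Q ^^ n) \<phi> v)
           \<le> cpl ^ n * (B * ((\<tau> powr \<gamma>) ^ n * \<rho> u v powr \<gamma>)) + (1 - cpl ^ n) * A"
  using uv
proof (induction n arbitrary: u v)
  case 0
  then show ?case using osc_holder_holder[OF \<phi>] by simp
next
  case (Suc n)
  let ?W = "cpl ^ n * (B * ((\<tau> powr \<gamma>) ^ n * (\<tau> powr \<gamma> * \<rho> u v powr \<gamma>))) + (1 - cpl ^ n) * A"
  have W: "AE g in M. cmod ((Q ^^ n) \<phi> (T g u) - (Q ^^ n) \<phi> (T g v)) \<le> ?W"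
    using T_in[OF Suc(2)] T_in[OF Suc(3)] T_contract[OF Suc(2,3)]
  proof eventually_elim
    case (elim g)
    have "\<rho> (T g u) (T g v) powr \<gamma> \<le> (\<tau> * \<rho> u v) powr \<gamma>"
      using rho_nonneg elim gamma by (intro powr_mono2) auto
    then have "cpl ^ n * (B * ((\<tau> powr \<gamma>) ^ n * \<rho> (T g u) (T g v) powr \<gamma>))
        \<le> cpl ^ n * (B * ((\<tau> powr \<gamma>) ^ n * (\<tau> powr \<gamma> * \<rho> u v powr \<gamma>)))"
      using AB tau rho_nonneg[OF Suc(2,3)] cpl by (intro mult_left_mono) (auto simp: powr_mult)
    then show ?case using Suc.IH[OF elim(1,2)] by linarith
  qed
  have pq: "AE g in M. cpl * q v g \<le> q u g" using q_compare[OF Suc(2,3)] q_nonneg[OF Suc(3)]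
  proof eventually_elim
    case (elim g)
    have "cpl \<le> (1 + \<rho> u v) powr (- \<sigma>)" unfolding cpl_def
      using rho_nonneg[OF Suc(2,3)] rho_le[OF Suc(2,3)] sigma by (intro powr_mono2') auto
    then have "cpl * q v g \<le> (1 + \<rho> u v) powr (- \<sigma>) * q v g" using elim by (intro mult_right_mono)
    then show ?case using elim by simp
  qed
  have "cmod (Q ((Q ^^ n) \<phi>) u - Q ((Q ^^ n) \<phi>) v) \<le> cpl * ?W + (1 - cpl) * A"
    using cpl by (intro Q_coupling[OF Q_funpow_osc_holder[OF \<phi> AB] Suc(2,3) _ _ pq W]) auto
  then show ?case by (simp add: algebra_simps)
qed

section \<open>Geometric decay from the two estimates\<close>

theorem spectral_gap:
  obtains C a where "0 < C" "0 < a" "a < 1"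
    "\<And>\<phi> A B n. osc_holder X \<rho> \<gamma> \<phi> A B \<Longrightarrow> 0 \<le> A \<Longrightarrow> 0 \<le> B \<Longrightarrow>
       osc_holder X \<rho> \<gamma> ((Q ^^ n) \<phi>) (C * a ^ n * (A + B)) (C * a ^ n * (A + B))"
proof -
  define t where "t = \<tau> powr \<gamma>"
  have t: "0 < t" "t < 1" using tau_gamma by (auto simp: t_def)
  have "0 < D * LY" using D LY_pos by simp
  then have "0 < inverse (2 * (2 * D * LY + 1))" by simp
  \<comment> \<open>The threshold is dictated by the coefficient
    \<open>t ^ m * (2 * D * LY + 1)\<close> of \<open>\<theta> * B\<close> in the block estimate,
    which has to be at most 1/2.\<close>
  then obtain m0 where m0: "t ^ m0 < inverse (2 * (2 * D * LY + 1))"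
    using real_arch_pow_inv t by blast
  \<comment> \<open>The successor keeps \<open>m\<close> positive, as \<open>root m\<close> and the
    division of \<open>n\<close> into blocks of length \<open>m\<close> require.\<close>
  define m where "m = Suc m0"
  have "t ^ m \<le> t ^ m0" using t by (simp add: m_def mult_le_cancel_right1)
  then have m: "t ^ m * (2 * D * LY + 1) \<le> 1 / 2" "0 < m"
  proof -
    have "t ^ m * (2 * (2 * D * LY + 1)) \<le> inverse (2 * (2 * D * LY + 1)) * (2 * (2 * D * LY + 1))"
      using m0 \<open>t ^ m \<le> t ^ m0\<close> D LY_pos by (intro mult_right_mono) auto
    also have "\<dots> = 1" using D LY_pos by (intro left_inverse) (smt (verit) mult_pos_pos)
    finally show "t ^ m * (2 * D * LY + 1) \<le> 1 / 2" by (simp add: algebra_simps)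
  qed (simp add: m_def)
  \<comment> \<open>With this weight the term \<open>LY * A\<close> of the new seminorm bound uses
    up exactly half of the gain \<open>cpl ^ m * A\<close> in the oscillation.\<close>
  define \<theta> where "\<theta> = cpl ^ m / (2 * LY)"
  define r where "r = max (1 / 2) (1 - cpl ^ m / 2)"
  have lam: "0 < \<theta>" "\<theta> * LY = cpl ^ m / 2" using cpl LY_pos by (auto simp: \<theta>_def)
  have r: "0 < r" "r < 1" "1 / 2 \<le> r" "1 - cpl ^ m / 2 \<le> r" using cpl by (auto simp: r_def)
  \<comment> \<open>The weighted norm \<open>A + \<theta> B\<close> contracts by the factor \<open>r\<close> every \<open>m\<close> steps.\<close>
  have block: "\<exists>A' B'. 0 \<le> A' \<and> 0 \<le> B' \<and> A' + \<theta> * B' \<le> r * (A + \<theta> * B) \<and> osc_holder X \<rho> \<gamma> ((Q ^^ m) \<phi>) A' B'"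
    if \<phi>: "osc_holder X \<rho> \<gamma> \<phi> A B" "0 \<le> A" "0 \<le> B" for \<phi> A B
  proof (intro exI conjI)
    let ?A = "cpl ^ m * (B * (t ^ m * D)) + (1 - cpl ^ m) * A" and ?B = "t ^ m * B + LY * A"
    have cm: "cpl ^ m \<le> 1" "0 < cpl ^ m" using cpl by (auto simp: power_le_one)
    show "0 \<le> ?A" "0 \<le> ?B" using \<phi> cm t D LY_pos by auto
    have "?A + \<theta> * ?B = (1 - cpl ^ m / 2) * A + t ^ m * (2 * D * LY + 1) * (\<theta> * B)"
    proof -
      have "cpl ^ m = 2 * \<theta> * LY" using lam by simp
      then show ?thesis by (simp add: algebra_simps)
    qed
    also have "\<dots> \<le> r * A + r * (\<theta> * B)"
      using r m lam \<phi> by (intro add_mono mult_right_mono) auto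
    finally show "?A + \<theta> * ?B \<le> r * (A + \<theta> * B)" by (simp add: algebra_simps)
    show "osc_holder X \<rho> \<gamma> ((Q ^^ m) \<phi>) ?A ?B"
      unfolding osc_holder_def
    proof (intro ballI conjI)
      fix u v assume uv: "u \<in> X" "v \<in> X"
      have "\<rho> u v powr \<gamma> \<le> D powr \<gamma>" using rho_nonneg[OF uv] rho_le[OF uv] gamma by (intro powr_mono2) auto
      also have "\<dots> \<le> D powr 1" using D gamma by (intro powr_mono) auto
      finally have "\<rho> u v powr \<gamma> \<le> D" using D by simp
      then have "cpl ^ m * (B * (t ^ m * \<rho> u v powr \<gamma>)) \<le> cpl ^ m * (B * (t ^ m * D))"
        using cm \<phi> t by (intro mult_left_mono) auto
      then show "cmod ((Q ^^ m) \<phi> u - (Q ^^ m) \<phi> v) \<le> ?A"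
        using Q_funpow_doeblin[OF \<phi> uv, of m] by (simp add: t_def)
      show "cmod ((Q ^^ m) \<phi> u - (Q ^^ m) \<phi> v) \<le> ?B * \<rho> u v powr \<gamma>"
        using osc_holder_holder[OF Q_funpow_osc_holder[OF \<phi>] uv, of m] by (simp add: t_def)
    qed
  qed
  have blocks: "\<exists>A' B'. 0 \<le> A' \<and> 0 \<le> B' \<and> A' + \<theta> * B' \<le> r ^ k * (A + \<theta> * B) \<and> osc_holder X \<rho> \<gamma> ((Q ^^ (m * k)) \<phi>) A' B'"
    if \<phi>: "osc_holder X \<rho> \<gamma> \<phi> A B" "0 \<le> A" "0 \<le> B" for \<phi> A B k
  proof (induction k)
    case 0
    then show ?case using \<phi> by auto
  next
    case (Suc k)
    then obtain A' B' where AB': "0 \<le> A'" "0 \<le> B'" "A' + \<theta> * B' \<le> r ^ k * (A + \<theta> * B)"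
      "osc_holder X \<rho> \<gamma> ((Q ^^ (m * k)) \<phi>) A' B'" by auto
    from block[OF AB'(4,1,2)] obtain A'' B'' where AB'': "0 \<le> A''" "0 \<le> B''"
      "A'' + \<theta> * B'' \<le> r * (A' + \<theta> * B')" "osc_holder X \<rho> \<gamma> ((Q ^^ m) ((Q ^^ (m * k)) \<phi>)) A'' B''" by auto
    have "r * (A' + \<theta> * B') \<le> r * (r ^ k * (A + \<theta> * B))" using AB'(3) r by (intro mult_left_mono) auto
    then have "A'' + \<theta> * B'' \<le> r ^ Suc k * (A + \<theta> * B)" using AB''(3) by simp
    moreover have "(Q ^^ m) ((Q ^^ (m * k)) \<phi>) = (Q ^^ (m * Suc k)) \<phi>" by (simp add: funpow_add)
    ultimately show ?case using AB'' by metis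
  qed
  define a where "a = root m r"
  have a: "0 < a" "a < 1" "a ^ m = r" using r m by (auto simp: a_def real_root_pow_pos)
  \<comment> \<open>The factor \<open>1 + 1 / \<theta> + LY\<close> recovers the two separate bounds
    from the weighted sum, including the last \<open>n mod m\<close> steps;
    \<open>1 + \<theta>\<close> passes from \<open>A + \<theta> * B\<close> to \<open>A + B\<close>;
    and \<open>1 / r\<close> pays for the unfinished block.\<close>
  define C where "C = (1 + 1 / \<theta> + LY) * (1 + \<theta>) / r"
  have C: "0 < C" using lam LY_pos r by (auto simp: C_def intro!: divide_pos_pos mult_pos_pos add_pos_pos)
  have "osc_holder X \<rho> \<gamma> ((Q ^^ n) \<phi>) (C * a ^ n * (A + B)) (C * a ^ n * (A + B))"
    if \<phi>: "osc_holder X \<rho> \<gamma> \<phi> A B" "0 \<le> A" "0 \<le> B" for \<phi> A B n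
  proof -
    obtain A' B' where AB': "0 \<le> A'" "0 \<le> B'" "A' + \<theta> * B' \<le> r ^ (n div m) * (A + \<theta> * B)"
      "osc_holder X \<rho> \<gamma> ((Q ^^ (m * (n div m))) \<phi>) A' B'" using blocks[OF \<phi>] by metis
    have "(Q ^^ n) \<phi> = (Q ^^ (n mod m)) ((Q ^^ (m * (n div m))) \<phi>)"
      by (metis comp_apply funpow_add mod_mult_div_eq)
    then have h: "osc_holder X \<rho> \<gamma> ((Q ^^ n) \<phi>) A' (t ^ (n mod m) * B' + LY * A')"
      using Q_funpow_osc_holder[OF AB'(4,1,2), of "n mod m"] by (simp add: t_def)
    have rn: "r ^ (n div m) \<le> a ^ n / r"
    proof -
      have "r * r ^ (n div m) = a ^ (m * Suc (n div m))" by (metis a(3) power_Suc power_mult)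
      also have "\<dots> \<le> a ^ n" using a m by (intro power_decreasing) (auto simp: dividend_less_times_div less_imp_le)
      finally show ?thesis using r by (simp add: field_simps)
    qed
    have "A' + \<theta> * B' \<le> (a ^ n / r) * (A + \<theta> * B)"
      using AB'(3) mult_right_mono[OF rn, of "A + \<theta> * B"] \<phi> lam by simp
    also have "\<dots> \<le> (a ^ n / r) * ((1 + \<theta>) * (A + B))"
      using \<phi> lam a r by (intro mult_left_mono) (auto simp: algebra_simps)
    finally have S: "A' + \<theta> * B' \<le> (a ^ n / r) * ((1 + \<theta>) * (A + B))" .
    have "B' \<le> (1 / \<theta>) * (A' + \<theta> * B')" using lam AB' by (simp add: field_simps)
    moreover have "LY * A' \<le> LY * (A' + \<theta> * B')" "A' \<le> A' + \<theta> * B'" "t ^ (n mod m) * B' \<le> B'"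
      using LY_pos AB' lam t by (auto intro!: mult_left_mono mult_left_le_one_le power_le_one)
    moreover have "0 \<le> (1 / \<theta>) * (A' + \<theta> * B')" "0 \<le> LY * (A' + \<theta> * B')" using lam LY_pos AB' by auto
    ultimately have 1: "A' \<le> (1 + 1 / \<theta> + LY) * (A' + \<theta> * B')"
        "t ^ (n mod m) * B' + LY * A' \<le> (1 + 1 / \<theta> + LY) * (A' + \<theta> * B')"
      using AB' by (auto simp: distrib_right)
    have "(1 + 1 / \<theta> + LY) * (A' + \<theta> * B') \<le> (1 + 1 / \<theta> + LY) * ((a ^ n / r) * ((1 + \<theta>) * (A + B)))"
      using S lam LY_pos by (intro mult_left_mono) auto
    also have "\<dots> = C * a ^ n * (A + B)" by (simp add: C_def)
    finally show ?thesis using 1 by (intro osc_holder_mono[OF h]) auto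
  qed
  with C a show ?thesis by (intro that) auto
qed

end

section \<open>Contraction by positive matrices\<close>

lemma sum_l1norm: "v \<in> SS \<Longrightarrow> (\<Sum>i\<in>UNIV. v $ i) = 1"
  by (auto simp: SS_def l1norm_def cong: sum.cong)

lemma SS_nonneg: "v \<in> SS \<Longrightarrow> 0 \<le> v $ i"
  by (simp add: SS_def)

lemma SS_le_1: "v \<in> SS \<Longrightarrow> v $ i \<le> 1"
  using member_le_sum[of i UNIV "($) v"] by (simp add: sum_l1norm SS_nonneg)

lemma SS_ex_pos:
  assumes "v \<in> SS" shows "\<exists>i. 0 < v $ i"
proof (rule ccontr)
  assume "\<not> (\<exists>i. 0 < v $ i)"
  then have "v $ i = 0" for i using SS_nonneg[OF assms, of i] by (metis antisym_conv2)
  then show False using sum_l1norm[OF assms] by simp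
qed

lemma axis_in_SS: "axis i 1 \<in> SS"
proof -
  have "axis i (1::real) $ j = (if j = i then 1 else 0)" for j by (simp add: axis_def)
  then show ?thesis by (simp add: SS_def l1norm_def if_distrib[of abs] cong: if_cong)
qed

lemma SSeps_in_SS: "v \<in> SSeps \<epsilon> \<Longrightarrow> v \<in> SS"
  by (simp add: SSeps_def)

lemma SSeps_inner: "v \<in> SSeps \<epsilon> \<Longrightarrow> f \<in> SS \<Longrightarrow> \<epsilon> \<le> f \<bullet> v"
  by (simp add: SSeps_def)

text \<open>Every vector of \<open>SS\<close> is a convex combination of the axis vectors, so it is
  enough to test against these.\<close>

lemma SSeps_iff: "v \<in> SSeps \<epsilon> \<longleftrightarrow> v \<in> SS \<and> (\<forall>i. \<epsilon> \<le> v $ i)"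
proof
  assume v: "v \<in> SSeps \<epsilon>"
  have "\<epsilon> \<le> v $ i" for i
    using SSeps_inner[OF v axis_in_SS[of i]] by (simp add: inner_axis inner_commute)
  then show "v \<in> SS \<and> (\<forall>i. \<epsilon> \<le> v $ i)" using v by (simp add: SSeps_in_SS)
next
  assume v: "v \<in> SS \<and> (\<forall>i. \<epsilon> \<le> v $ i)"
  have "\<epsilon> \<le> f \<bullet> v" if f: "f \<in> SS" for f
  proof -
    have "\<epsilon> = (\<Sum>i\<in>UNIV. f $ i * \<epsilon>)" using sum_l1norm[OF f] by (simp flip: sum_distrib_right)
    also have "\<dots> \<le> (\<Sum>i\<in>UNIV. f $ i * v $ i)" using v SS_nonneg[OF f] by (intro sum_mono mult_left_mono) auto
    finally show ?thesis by (simp add: inner_vec_def)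
  qed
  then show "v \<in> SSeps \<epsilon>" using v by (simp add: SSeps_def)
qed

lemma inner_le_1: "u \<in> SS \<Longrightarrow> v \<in> SS \<Longrightarrow> u \<bullet> v \<le> 1"
proof -
  assume uv: "u \<in> SS" "v \<in> SS"
  have "(\<Sum>i\<in>UNIV. u $ i * v $ i) \<le> (\<Sum>i\<in>UNIV. u $ i * 1)"
    using uv SS_le_1 SS_nonneg by (intro sum_mono mult_left_mono) auto
  then show "u \<bullet> v \<le> 1" using sum_l1norm[OF uv(1)] by (simp add: inner_vec_def)
qed

lemma inner_pos:
  fixes w u :: "real ^ 'n"
  assumes "\<And>i. 0 < w $ i" "u \<in> SS" shows "0 < w \<bullet> u"
proof -
  obtain i where "0 < u $ i" using SS_ex_pos[OF assms(2)] by blast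
  then have "0 < w $ i * u $ i" using assms by simp
  also have "\<dots> \<le> (\<Sum>i\<in>UNIV. w $ i * u $ i)"
    using assms(1) SS_nonneg[OF assms(2)] by (intro member_le_sum) (auto simp: less_imp_le)
  finally show ?thesis by (simp add: inner_vec_def)
qed

lemma closed_SSeps: "closed (SSeps \<epsilon> :: (real ^ 'n) set)"
proof -
  have "(SSeps \<epsilon> :: (real ^ 'n) set) = (\<Inter>i. {v. 0 \<le> v $ i}) \<inter> {v. l1norm v = 1} \<inter> (\<Inter>i. {v. \<epsilon> \<le> v $ i})"
    by (auto simp: SSeps_iff SS_def)
  moreover have "closed \<dots>" unfolding l1norm_def
    by (intro closed_Int closed_INT ballI closed_Collect_le closed_Collect_eq continuous_intros)
  ultimately show ?thesis by (simp only:)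
qed

lemma l1norm_pos_vec: "(\<And>i. 0 < w $ i) \<Longrightarrow> 0 < l1norm w"
  unfolding l1norm_def by (intro sum_pos) (auto simp: less_imp_neq[THEN not_sym])

lemma pos_mat_vec_pos:
  assumes "pos_mat g" "v \<in> SS" shows "0 < (g *v v) $ i"
proof -
  have "0 < g $ i \<bullet> v" using assms by (intro inner_pos) (auto simp: pos_mat_def)
  then show ?thesis by (simp add: matrix_vector_mult_def inner_vec_def)
qed

lemma pos_mat_l1norm: "pos_mat g \<Longrightarrow> v \<in> SS \<Longrightarrow> 0 < l1norm (g *v v)"
  by (simp add: l1norm_pos_vec pos_mat_vec_pos)

lemma act_scale: "pos_mat g \<Longrightarrow> v \<in> SS \<Longrightarrow> l1norm (g *v v) *\<^sub>R act g v = g *v v"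
  using pos_mat_l1norm[of g v] by (simp add: act_def)

text \<open>The quantity \<open>max (u/v) / min (u/v) - 1\<close>, comparable to \<^const>\<open>hdist\<close> on \<^const>\<open>SSeps\<close> but
  contracted by positive matrices in an elementary way.\<close>

definition ratio_dist :: "real ^ 'n \<Rightarrow> real ^ 'n \<Rightarrow> real" where
  "ratio_dist u v = 1 / (mcr u v * mcr v u) - 1"

text \<open>For strictly positive vectors the supremum is attained: it is the least of the finitely
  many ratios \<open>u $ i / v $ i\<close>.\<close>

lemma mcr_props:
  fixes u v :: "real ^ 'n"
  assumes u: "\<And>i. 0 < u $ i" and v: "\<And>i. 0 < v $ i"
  shows mcr_le: "mcr u v * v $ i \<le> u $ i"
    and mcr_pos: "0 < mcr u v"
    and mcr_greatest: "(\<And>i. l * v $ i \<le> u $ i) \<Longrightarrow> l \<le> mcr u v"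
proof -
  let ?m = "Min (range (\<lambda>i. u $ i / v $ i))"
  have le: "?m * v $ i \<le> u $ i" for i
  proof -
    have "?m \<le> u $ i / v $ i" by (intro Min_le rangeI) simp
    then show ?thesis using v[of i] by (simp add: field_simps)
  qed
  have "?m \<in> range (\<lambda>i. u $ i / v $ i)" by (rule Min_in) auto
  then obtain k where k: "?m = u $ k / v $ k" unfolding image_iff by blast
  have ge: "l \<le> ?m" if "\<And>i. l * v $ i \<le> u $ i" for l
    using that[of k] v[of k] unfolding k by (simp add: field_simps)
  have pos: "0 < ?m" unfolding k using u[of k] v[of k] by simp
  have eq: "mcr u v = ?m" unfolding mcr_def
    by (intro cSup_eq_maximum CollectI conjI allI le ge less_imp_le[OF pos]) blast
  show "mcr u v * v $ i \<le> u $ i" "0 < mcr u v"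
    "(\<And>i. l * v $ i \<le> u $ i) \<Longrightarrow> l \<le> mcr u v"
    using le[of i] ge[of l] pos unfolding eq by auto
qed

section \<open>Comparison of distances on the inner part of the simplex, and contraction\<close>

context
  fixes \<epsilon> :: real
  assumes eps: "0 < \<epsilon>" "\<epsilon> < 1"
begin

lemma SSeps_pos: "v \<in> SSeps \<epsilon> \<Longrightarrow> 0 < v $ i"
  using eps by (auto simp: SSeps_iff intro: less_le_trans)

lemma mcr_SSeps_ge: "u \<in> SSeps \<epsilon> \<Longrightarrow> v \<in> SSeps \<epsilon> \<Longrightarrow> \<epsilon> \<le> mcr u v"
proof -
  assume uv: "u \<in> SSeps \<epsilon>" "v \<in> SSeps \<epsilon>"
  have "\<epsilon> * v $ i \<le> u $ i" for i
    using uv eps SS_le_1[of v i] SSeps_pos[OF uv(2), of i] by (auto simp: SSeps_iff intro: order_trans[of _ \<epsilon>])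
  then show ?thesis using uv by (intro mcr_greatest SSeps_pos) auto
qed

lemma mcr_SSeps_le_1: "u \<in> SSeps \<epsilon> \<Longrightarrow> v \<in> SSeps \<epsilon> \<Longrightarrow> mcr u v \<le> 1"
proof -
  assume uv: "u \<in> SSeps \<epsilon>" "v \<in> SSeps \<epsilon>"
  have "(\<Sum>i\<in>UNIV. mcr u v * v $ i) \<le> (\<Sum>i\<in>UNIV. u $ i)"
    using uv by (intro sum_mono mcr_le SSeps_pos) auto
  then show ?thesis using uv by (simp add: sum_l1norm SSeps_in_SS flip: sum_distrib_left)
qed

text \<open>Otherwise \<open>v\<close> is at most \<open>u\<close> in every coordinate, and equal
  coordinate sums force \<open>u = v\<close>.\<close>

lemma mcr_SSeps_less_1:
  assumes uv: "u \<in> SSeps \<epsilon>" "v \<in> SSeps \<epsilon>" "u \<noteq> v"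
  shows "mcr u v < 1"
proof (rule ccontr)
  assume "\<not> mcr u v < 1"
  then have m: "mcr u v = 1" using mcr_SSeps_le_1[OF uv(1,2)] by simp
  have le: "v $ i \<le> u $ i" for i using mcr_le[of u v i] uv m by (simp add: SSeps_pos)
  have "(\<Sum>i\<in>UNIV. u $ i - v $ i) = 0"
    using uv by (simp add: sum_subtractf sum_l1norm SSeps_in_SS)
  then have "u $ i - v $ i = 0" for i
    using le by (subst (asm) sum_nonneg_eq_0_iff) auto
  then show False using uv(3) by (auto simp: vec_eq_iff)
qed

lemma mcr_product:
  assumes uv: "u \<in> SSeps \<epsilon>" "v \<in> SSeps \<epsilon>"
  shows "\<epsilon>\<^sup>2 \<le> mcr u v * mcr v u" "mcr u v * mcr v u \<le> 1" "0 < mcr u v * mcr v u"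
proof -
  show "\<epsilon>\<^sup>2 \<le> mcr u v * mcr v u" unfolding power2_eq_square
    using mcr_SSeps_ge[OF uv] mcr_SSeps_ge[OF uv(2,1)] eps by (intro mult_mono) auto
  then show "0 < mcr u v * mcr v u" using eps by (auto intro: less_le_trans[of _ "\<epsilon>\<^sup>2"])
  show "mcr u v * mcr v u \<le> 1"
    using mcr_SSeps_le_1[OF uv] mcr_SSeps_le_1[OF uv(2,1)] mcr_SSeps_ge[OF uv(2,1)] eps by (intro mult_le_one) auto
qed

lemma ratio_dist_nonneg: "u \<in> SSeps \<epsilon> \<Longrightarrow> v \<in> SSeps \<epsilon> \<Longrightarrow> 0 \<le> ratio_dist u v"
  using mcr_product[of u v] by (simp add: ratio_dist_def)

lemma ratio_dist_le: "u \<in> SSeps \<epsilon> \<Longrightarrow> v \<in> SSeps \<epsilon> \<Longrightarrow> ratio_dist u v \<le> 1 / \<epsilon>\<^sup>2"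
  using mcr_product[of u v] eps frac_le[of 1 1 "\<epsilon>\<^sup>2" "mcr u v * mcr v u"] by (simp add: ratio_dist_def)

lemma ratio_dist_eq:
  assumes "u \<in> SSeps \<epsilon>" "v \<in> SSeps \<epsilon>"
  shows "ratio_dist u v = (1 - mcr u v * mcr v u) / (mcr u v * mcr v u)"
proof -
  have "1 / y - 1 = (1 - y) / y" if "0 < y" for y :: real using that by (simp add: diff_divide_distrib)
  from this[OF mcr_product(3)[OF assms]] show ?thesis by (simp only: ratio_dist_def)
qed

text \<open>With \<open>x\<close> the product of the two multipliers, \<open>hdist\<close> is
  \<open>(1 - x) / (1 + x)\<close> and \<open>ratio_dist\<close> is \<open>(1 - x) / x\<close>. They
  differ by the factor \<open>(1 + x) / x\<close>, which for
  \<open>\<epsilon>\<^sup>2 \<le> x \<le> 1\<close> lies between 1 and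
  \<open>2 / \<epsilon>\<^sup>2\<close>; the next lemma is the other half.\<close>

lemma hdist_le_ratio_dist:
  assumes uv: "u \<in> SSeps \<epsilon>" "v \<in> SSeps \<epsilon>"
  shows "hdist u v \<le> ratio_dist u v"
proof -
  let ?x = "mcr u v * mcr v u"
  have "(1 - ?x) / (1 + ?x) \<le> (1 - ?x) / ?x" using mcr_product[OF uv] by (intro frac_le) auto
  also have "\<dots> = ratio_dist u v" by (simp only: ratio_dist_eq[OF uv])
  finally show ?thesis by (simp add: hdist_def)
qed

lemma ratio_dist_le_hdist:
  assumes uv: "u \<in> SSeps \<epsilon>" "v \<in> SSeps \<epsilon>"
  shows "ratio_dist u v \<le> 2 / \<epsilon>\<^sup>2 * hdist u v"
proof -
  let ?x = "mcr u v * mcr v u"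
  have x: "\<epsilon>\<^sup>2 \<le> ?x" "?x \<le> 1" "0 < ?x" using mcr_product[OF uv] by auto
  have "ratio_dist u v = (1 + ?x) / ?x * hdist u v"
  proof -
    have "(1 - y) / y = (1 + y) / y * ((1 - y) / (1 + y))" if "0 < y" for y :: real
      using that by simp
    from this[OF x(3)] show ?thesis by (simp only: ratio_dist_eq[OF uv] hdist_def)
  qed
  also have "\<dots> \<le> 2 / \<epsilon>\<^sup>2 * hdist u v"
    using x eps by (intro mult_right_mono frac_le) (auto simp: hdist_def)
  finally show ?thesis .
qed

text \<open>Division by zero yields zero, so without this the quotients in \<open>Bnorm\<close>
  would carry no information.\<close>

lemma hdist_pos:
  assumes uv: "u \<in> SSeps \<epsilon>" "v \<in> SSeps \<epsilon>" "u \<noteq> v"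
  shows "0 < hdist u v"
proof -
  have "mcr u v * mcr v u \<le> mcr u v * 1"
    using mcr_SSeps_le_1[OF uv(2,1)] mcr_SSeps_ge[OF uv(1,2)] eps by (intro mult_left_mono) auto
  then have "mcr u v * mcr v u < 1" using mcr_SSeps_less_1[OF uv] by simp
  then show ?thesis using mcr_product[OF uv(1,2)] by (simp add: hdist_def)
qed

text \<open>The link to the Euclidean metric, in which continuity and the Borel sets are
  meant.\<close>

lemma ratio_dist_le_dist:
  assumes uv: "u \<in> SSeps \<epsilon>" "v \<in> SSeps \<epsilon>"
  shows "ratio_dist u v \<le> 2 / \<epsilon> ^ 3 * dist u v"
proof -
  have *: "1 - dist u v / \<epsilon> \<le> mcr u v" if uv: "u \<in> SSeps \<epsilon>" "v \<in> SSeps \<epsilon>" for u v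
  proof (rule mcr_greatest)
    fix i
    have "v $ i - u $ i \<le> dist u v" using component_le_norm_cart[of "u - v" i] by (simp add: dist_norm)
    also have "\<dots> \<le> dist u v / \<epsilon> * v $ i"
      using uv eps mult_right_mono[of \<epsilon> "v $ i" "dist u v"] by (auto simp: SSeps_iff field_simps)
    finally show "(1 - dist u v / \<epsilon>) * v $ i \<le> u $ i" by (simp add: left_diff_distrib)
  qed (use uv SSeps_pos in auto)
  let ?x = "mcr u v * mcr v u"
  have x: "\<epsilon>\<^sup>2 \<le> ?x" "?x \<le> 1" "0 < ?x" using mcr_product[OF uv] by auto
  have "1 - ?x = (1 - mcr u v) + mcr u v * (1 - mcr v u)" by (simp add: algebra_simps)
  also have "\<dots> \<le> (1 - mcr u v) + 1 * (1 - mcr v u)"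
    using mcr_SSeps_le_1[OF uv] mcr_SSeps_le_1[OF uv(2,1)] by (intro add_left_mono mult_right_mono) auto
  also have "\<dots> \<le> 2 * dist u v / \<epsilon>" using *[OF uv] *[OF uv(2,1)] by (simp add: dist_commute)
  finally have "(1 - ?x) / ?x \<le> (2 * dist u v / \<epsilon>) / \<epsilon>\<^sup>2"
    using x eps by (intro frac_le) auto
  then show ?thesis by (simp add: ratio_dist_eq[OF uv] power2_eq_square power3_eq_cube mult.assoc)
qed

text \<open>Since each column of \<open>g\<close> is, up to scaling, in \<^term>\<open>SSeps \<epsilon>\<close>, every coordinate of \<open>g u / g v\<close> is
  an average of the \<open>u $ j / v $ j\<close> whose weights dominate \<open>\<epsilon>\<close> times a fixed probability vector.\<close>

lemma ratio_dist_act: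
  assumes g: "pos_mat g" and ga: "\<And>w. w \<in> SS \<Longrightarrow> act g w \<in> SSeps \<epsilon>"
    and uv: "u \<in> SSeps \<epsilon>" "v \<in> SSeps \<epsilon>"
  shows "ratio_dist (act g u) (act g v) \<le> (1 - \<epsilon>) * ratio_dist u v"
proof -
  note SS = uv[THEN SSeps_in_SS]
  define c where "c j = (\<Sum>k\<in>UNIV. g $ k $ j)" for j
  have gp: "0 < g $ i $ j" for i j using g by (simp add: pos_mat_def)
  have c0: "0 < c j" for j by (simp add: c_def sum_pos gp)
  have gc: "g $ i $ j \<le> c j" for i j unfolding c_def using gp by (intro member_le_sum) (auto simp: less_imp_le)
  \<comment> \<open>The image of the \<open>j\<close>-th axis vector under \<open>act g\<close> is
    the \<open>j\<close>-th column divided by its sum \<open>c j\<close>, and it lies in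
    \<open>SSeps \<epsilon>\<close>.\<close>
  have cg: "\<epsilon> * c j \<le> g $ i $ j" for i j
  proof -
    have e: "(g *v axis j 1) $ k = g $ k $ j" for k
      by (simp add: matrix_vector_mult_def axis_def if_distrib[where f="\<lambda>x. _ * x"] cong: if_cong)
    then have l: "l1norm (g *v axis j 1) = c j" using gp by (simp add: l1norm_def c_def less_imp_le)
    have "\<epsilon> \<le> act g (axis j 1) $ i" using ga[OF axis_in_SS[of j]] by (simp add: SSeps_iff)
    then show ?thesis using c0[of j] unfolding act_def l by (simp add: e field_simps)
  qed
  have cmp: "\<epsilon> * (\<Sum>j\<in>UNIV. c j * w $ j) \<le> (g *v w) $ i" "(g *v w) $ i \<le> (\<Sum>j\<in>UNIV. c j * w $ j)"
    if "\<And>j. 0 \<le> w $ j" for w i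
    unfolding matrix_vector_mult_def sum_distrib_left vec_lambda_beta
    using cg gc that by (auto intro!: sum_mono mult_right_mono simp flip: mult.assoc)
  define m M where "m = mcr u v" and "M = 1 / mcr v u"
  have m: "0 < m" "\<And>j. m * v $ j \<le> u $ j" and M: "0 < M" "\<And>j. u $ j \<le> M * v $ j"
    using uv by (auto simp: m_def M_def mcr_pos mcr_le SSeps_pos field_simps)
  \<comment> \<open>\<open>t\<close> is the mean of the ratios \<open>u $ j / v $ j\<close> with
    weights proportional to \<open>c j * v $ j\<close>. It does not depend on the row, so all
    coordinates of the image ratio are pulled towards the same number.\<close>
  define S t where "S = (\<Sum>j\<in>UNIV. c j * v $ j)" and "t = (\<Sum>j\<in>UNIV. c j * u $ j) / S"
  have S: "0 < S" unfolding S_def using c0 uv by (intro sum_pos) (auto simp: SSeps_pos)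
  have tS: "(\<Sum>j\<in>UNIV. c j * u $ j) = t * S" using S by (simp add: t_def)
  have gv: "0 < (g *v v) $ i" "0 < (g *v u) $ i" "(g *v v) $ i \<le> S" for i
    using pos_mat_vec_pos[OF g] SS cmp(2)[of v i] by (auto simp: S_def SS_nonneg)
  have "(\<Sum>j\<in>UNIV. c j * (u - m *s v) $ j) = (t - m) * S"
    by (simp add: right_diff_distrib left_diff_distrib sum_subtractf tS S_def sum_distrib_left algebra_simps)
  moreover have "g *v (u - m *s v) = g *v u - m *s (g *v v)"
    by (simp add: matrix_vector_mult_diff_distrib vector_scalar_commute)
  ultimately have lo: "\<epsilon> * ((t - m) * S) \<le> (g *v u) $ i - m * (g *v v) $ i" for i
    using cmp(1)[of "u - m *s v" i] m by simp
  have "(\<Sum>j\<in>UNIV. c j * (M *s v - u) $ j) = (M - t) * S"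
    by (simp add: right_diff_distrib left_diff_distrib sum_subtractf tS S_def sum_distrib_left algebra_simps)
  moreover have "g *v (M *s v - u) = M *s (g *v v) - g *v u"
    by (simp add: matrix_vector_mult_diff_distrib vector_scalar_commute)
  ultimately have hi: "\<epsilon> * ((M - t) * S) \<le> M * (g *v v) $ i - (g *v u) $ i" for i
    using cmp(1)[of "M *s v - u" i] M by simp
  have tm: "m \<le> t" "t \<le> M"
  proof -
    have "m * S \<le> t * S" unfolding tS[symmetric] unfolding S_def sum_distrib_left
      using m(2) c0 by (intro sum_mono) (simp add: less_imp_le mult.left_commute)
    then show "m \<le> t" using S by simp
    have "t * S \<le> M * S" unfolding tS[symmetric] unfolding S_def sum_distrib_left
      using M(2) c0 by (intro sum_mono) (simp add: less_imp_le mult.left_commute)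
    then show "t \<le> M" using S by simp
  qed
  \<comment> \<open>Both ends of the interval of ratios move towards \<open>t\<close> by the
    fraction \<open>\<epsilon>\<close>: the vectors \<open>u - m *s v\<close> and
    \<open>M *s v - u\<close> are non-negative, and \<open>cmp\<close> bounds every coordinate of
    their images from below.\<close>
  define m' M' where "m' = m + \<epsilon> * (t - m)" and "M' = M - \<epsilon> * (M - t)"
  have mm': "m \<le> m'" using eps tm by (simp add: m'_def)
  then have m': "m \<le> m'" "M' - m' = (1 - \<epsilon>) * (M - m)" "0 < m'"
    using m by (auto simp: m'_def M'_def algebra_simps)
  have "m' \<le> M'" using m' eps tm by (smt (verit) mult_nonneg_nonneg)
  then have M'0: "0 < M'" using m' by simp
  have lo': "m' * (g *v v) $ i \<le> (g *v u) $ i" for i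
  proof -
    have "\<epsilon> * (t - m) * (g *v v) $ i \<le> \<epsilon> * (t - m) * S" using gv(3) tm eps by (intro mult_left_mono) auto
    then show ?thesis using lo[of i] by (simp add: m'_def algebra_simps)
  qed
  have hi': "(g *v u) $ i \<le> M' * (g *v v) $ i" for i
  proof -
    have "\<epsilon> * (M - t) * (g *v v) $ i \<le> \<epsilon> * (M - t) * S" using gv(3) tm eps by (intro mult_left_mono) auto
    then show ?thesis using hi[of i] by (simp add: M'_def algebra_simps)
  qed
  define a b where "a = l1norm (g *v u)" and "b = l1norm (g *v v)"
  have ab: "0 < a" "0 < b" using pos_mat_l1norm[OF g] SS by (auto simp: a_def b_def)
  have act: "act g u $ i = (g *v u) $ i / a" "act g v $ i = (g *v v) $ i / b" for i
    by (simp_all add: act_def a_def b_def)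
  have actp: "0 < act g u $ i" "0 < act g v $ i" for i using gv ab by (auto simp: act)
  \<comment> \<open>The normalisations \<open>a\<close> and \<open>b\<close> enter the two
    multipliers inversely and cancel in the product.\<close>
  have "m' * b / a \<le> mcr (act g u) (act g v)"
    using lo' ab by (intro mcr_greatest actp) (simp add: act divide_right_mono)
  moreover have "a / (M' * b) \<le> mcr (act g v) (act g u)"
    using hi' ab M'0 by (intro mcr_greatest actp) (simp add: act field_simps)
  ultimately have "(m' * b / a) * (a / (M' * b)) \<le> mcr (act g u) (act g v) * mcr (act g v) (act g u)"
    using ab M'0 m' by (intro mult_mono) (auto intro: less_imp_le mcr_pos[OF actp(1) actp(2)])
  then have "m' / M' \<le> mcr (act g u) (act g v) * mcr (act g v) (act g u)" using ab by simp
  then have "1 / (mcr (act g u) (act g v) * mcr (act g v) (act g u)) \<le> 1 / (m' / M')"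
    using m' M'0 by (intro frac_le) auto
  then have "ratio_dist (act g u) (act g v) \<le> (M' - m') / m'"
    using m'(3) by (simp add: ratio_dist_def diff_divide_distrib)
  also have "\<dots> \<le> (1 - \<epsilon>) * (M - m) / m" unfolding m'(2) using m' m eps tm by (intro divide_left_mono) auto
  also have "\<dots> = (1 - \<epsilon>) * ((M - m) / m)" by simp
  also have "(M - m) / m = ratio_dist u v"
  proof -
    have "(1 / y - x) / x = 1 / (x * y) - 1" if "0 < x" "0 < y" for x y :: real
      using that by (simp add: field_simps)
    from this[of "mcr u v" "mcr v u"] show ?thesis using uv by (simp add: ratio_dist_def m_def M_def mcr_pos SSeps_pos)
  qed
  finally show ?thesis by simp
qed

text \<open>This is where measurability comes from: a function continuous on the closed set
  \<open>SSeps \<epsilon>\<close> and cut off by its indicator is Borel.\<close>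

lemma osc_holder_imp_continuous:
  fixes \<phi> :: "real ^ 'n \<Rightarrow> complex"
  assumes "0 < \<gamma>" "osc_holder (SSeps \<epsilon>) ratio_dist \<gamma> \<phi> A B"
  shows "continuous_on (SSeps \<epsilon>) \<phi>"
  unfolding continuous_on
proof
  fix v :: "real ^ 'n" assume v: "v \<in> SSeps \<epsilon>"
  let ?F = "at v within SSeps \<epsilon>"
  have "((\<lambda>u. \<bar>B\<bar> * (2 / \<epsilon> ^ 3 * dist u v) powr \<gamma>) \<longlongrightarrow> \<bar>B\<bar> * (2 / \<epsilon> ^ 3 * dist v v) powr \<gamma>) ?F"
    using assms(1) eps by (intro tendsto_intros) (auto intro: always_eventually)
  then have "((\<lambda>u. \<bar>B\<bar> * (2 / \<epsilon> ^ 3 * dist u v) powr \<gamma>) \<longlongrightarrow> 0) ?F" by simp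
  moreover have "\<forall>\<^sub>F u in ?F. norm (\<phi> u - \<phi> v) \<le> \<bar>B\<bar> * (2 / \<epsilon> ^ 3 * dist u v) powr \<gamma>"
    unfolding eventually_at
  proof (intro exI[of _ 1] conjI ballI impI)
    fix u :: "real ^ 'n" assume u: "u \<in> SSeps \<epsilon>"
    have "norm (\<phi> u - \<phi> v) \<le> B * ratio_dist u v powr \<gamma>" by (rule osc_holder_holder[OF assms(2) u v])
    also have "\<dots> \<le> \<bar>B\<bar> * (2 / \<epsilon> ^ 3 * dist u v) powr \<gamma>"
      using ratio_dist_nonneg[OF u v] ratio_dist_le_dist[OF u v] assms(1)
      by (intro mult_mono powr_mono2) auto
    finally show "norm (\<phi> u - \<phi> v) \<le> \<bar>B\<bar> * (2 / \<epsilon> ^ 3 * dist u v) powr \<gamma>" .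
  qed simp
  ultimately have "((\<lambda>u. \<phi> u - \<phi> v) \<longlongrightarrow> 0) ?F" by (rule Lim_null_comparison[rotated])
  then show "(\<phi> \<longlongrightarrow> \<phi> v) ?F" by (simp add: LIM_zero_iff)
qed

section \<open>Translation between \<open>Bnorm\<close> and \<open>osc_holder\<close>\<close>

lemma Bnorm_imp_bound:
  fixes \<phi> :: "real ^ 'n \<Rightarrow> complex"
  assumes "Bnorm \<epsilon> \<gamma> \<phi> \<le> ennreal b" "0 \<le> b" "v \<in> SSeps \<epsilon>"
  shows "cmod (\<phi> v) \<le> b"
proof -
  have "ennreal (cmod (\<phi> v)) \<le> (SUP v\<in>SSeps \<epsilon>. ennreal (cmod (\<phi> v)))" using assms(3) by (rule SUP_upper)
  also have "\<dots> \<le> ennreal b" using assms(1) unfolding Bnorm_def by (rule order_trans[rotated]) simp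
  finally show ?thesis using assms(2) by simp
qed

lemma Bnorm_imp_osc_holder:
  fixes \<phi> :: "real ^ 'n \<Rightarrow> complex"
  assumes "Bnorm \<epsilon> \<gamma> \<phi> \<le> ennreal b" "0 \<le> b" "0 \<le> \<gamma>"
  shows "osc_holder (SSeps \<epsilon>) ratio_dist \<gamma> \<phi> (2 * b) b"
  unfolding osc_holder_def
proof (intro ballI conjI)
  fix u v :: "real ^ 'n" assume uv: "u \<in> SSeps \<epsilon>" "v \<in> SSeps \<epsilon>"
  show "cmod (\<phi> u - \<phi> v) \<le> 2 * b"
    using norm_triangle_ineq4[of "\<phi> u" "\<phi> v"] Bnorm_imp_bound[OF assms(1,2)] uv by (smt (verit))
  show "cmod (\<phi> u - \<phi> v) \<le> b * ratio_dist u v powr \<gamma>"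
  proof (cases "u = v")
    case False
    have "ennreal (cmod (\<phi> u - \<phi> v) / hdist u v powr \<gamma>)
       \<le> (SUP (u, v)\<in>{(u, v). u \<in> SSeps \<epsilon> \<and> v \<in> SSeps \<epsilon> \<and> u \<noteq> v}. ennreal (cmod (\<phi> u - \<phi> v) / hdist u v powr \<gamma>))"
      using uv False by (intro SUP_upper2[of "(u, v)"]) auto
    also have "\<dots> \<le> ennreal b" using assms(1) unfolding Bnorm_def by (rule order_trans[rotated]) simp
    finally have "cmod (\<phi> u - \<phi> v) / hdist u v powr \<gamma> \<le> b" using assms(2) by simp
    then have "cmod (\<phi> u - \<phi> v) \<le> b * hdist u v powr \<gamma>" using hdist_pos[OF uv False] by (simp add: field_simps)
    also have "\<dots> \<le> b * ratio_dist u v powr \<gamma>"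
      using assms hdist_pos[OF uv False] hdist_le_ratio_dist[OF uv] by (intro mult_left_mono powr_mono2) auto
    finally show ?thesis .
  qed (use assms in simp)
qed

text \<open>The sup bound \<open>S\<close> is a separate premise because \<open>osc_holder\<close>
  is blind to constants. Returning from \<open>ratio_dist\<close> to \<open>hdist\<close> costs
  \<open>(2 / \<epsilon>\<^sup>2) powr \<gamma>\<close>.\<close>

lemma Bnorm_le:
  fixes \<phi> :: "real ^ 'n \<Rightarrow> complex"
  assumes "osc_holder (SSeps \<epsilon>) ratio_dist \<gamma> \<phi> A B" "0 \<le> A" "0 \<le> B" "0 \<le> \<gamma>" "0 \<le> S"
    and S: "\<And>v. v \<in> SSeps \<epsilon> \<Longrightarrow> cmod (\<phi> v) \<le> S"
  shows "Bnorm \<epsilon> \<gamma> \<phi> \<le> ennreal (S + B * (2 / \<epsilon>\<^sup>2) powr \<gamma>)"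
proof -
  have "(SUP (u, v)\<in>{(u, v). u \<in> SSeps \<epsilon> \<and> v \<in> SSeps \<epsilon> \<and> u \<noteq> v}. ennreal (cmod (\<phi> u - \<phi> v) / hdist u v powr \<gamma>))
      \<le> ennreal (B * (2 / \<epsilon>\<^sup>2) powr \<gamma>)"
  proof (rule SUP_least, safe, rule ennreal_leI)
    fix u v :: "real ^ 'n" assume uv: "u \<in> SSeps \<epsilon>" "v \<in> SSeps \<epsilon>" "u \<noteq> v"
    have "cmod (\<phi> u - \<phi> v) \<le> B * ratio_dist u v powr \<gamma>" by (rule osc_holder_holder[OF assms(1) uv(1,2)])
    also have "\<dots> \<le> B * (2 / \<epsilon>\<^sup>2 * hdist u v) powr \<gamma>"
      using ratio_dist_nonneg[OF uv(1,2)] ratio_dist_le_hdist[OF uv(1,2)] assms by (intro mult_left_mono powr_mono2) auto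
    also have "\<dots> = B * (2 / \<epsilon>\<^sup>2) powr \<gamma> * hdist u v powr \<gamma>" using hdist_pos[OF uv] by (subst powr_mult) auto
    finally show "cmod (\<phi> u - \<phi> v) / hdist u v powr \<gamma> \<le> B * (2 / \<epsilon>\<^sup>2) powr \<gamma>"
      using hdist_pos[OF uv] by (simp add: field_simps)
  qed
  moreover have "(SUP v\<in>SSeps \<epsilon>. ennreal (cmod (\<phi> v))) \<le> ennreal S" using S by (intro SUP_least ennreal_leI) auto
  ultimately show ?thesis unfolding Bnorm_def using assms by (subst ennreal_plus) (auto intro: add_mono)
qed

end

section \<open>Transfer operators of positive random matrices\<close>

text \<open>A point outside the support has a null basic neighbourhood, and a countable basis has
  only countably many of those. This turns hypotheses on the support into almost sure
  statements.\<close>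

lemma AE_msupp:
  fixes M :: "'a::second_countable_topology measure"
  assumes sets: "sets M = sets (restrict_space borel X)"
  shows "AE x in M. x \<in> msupp M"
proof -
  obtain B :: "'a set set" where B: "countable B" "topological_basis B"
    using ex_countable_basis by blast
  define N where "N = {U \<in> B. emeasure M (U \<inter> space M) = 0}"
  have sp: "space M = X" using sets_eq_imp_space_eq[OF sets] by (simp add: space_restrict_space)
  have "U \<inter> space M \<in> null_sets M" if "U \<in> N" for U
  proof -
    have "open U" using that B(2) by (auto simp: N_def topological_basis_open)
    then have "U \<inter> space M \<in> sets M" unfolding sets sp sets_restrict_space by (auto simp: Int_commute)
    then show ?thesis using that by (simp add: N_def null_sets_def)
  qed
  moreover have "countable N" using B(1) by (simp add: N_def)
  ultimately have null: "(\<Union>U\<in>N. U \<inter> space M) \<in> null_sets M" by (intro null_sets_UN') auto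
  have "x \<in> msupp M" if x: "x \<in> space M" "x \<notin> (\<Union>U\<in>N. U \<inter> space M)" for x
    unfolding msupp_def
  proof (intro CollectI conjI allI impI x(1))
    fix U assume U: "open U" "x \<in> U"
    then obtain V where V: "V \<in> B" "x \<in> V" "V \<subseteq> U" using B(2) by (meson topological_basisE)
    then have "V \<notin> N" using x by auto
    then have "0 < emeasure M (V \<inter> space M)" using V by (simp add: N_def zero_less_iff_neq_zero)
    also have "\<dots> \<le> emeasure M (U \<inter> space M)"
    proof (rule emeasure_mono)
      show "U \<inter> space M \<in> sets M" using U unfolding sets sp sets_restrict_space by (auto simp: Int_commute)
    qed (use V in auto)
    finally show "0 < emeasure M (U \<inter> space M)" .
  qed
  then show ?thesis using AE_not_in[OF null] by (auto elim!: AE_mp)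
qed

text \<open>Minimum and maximum over the end points cover both signs of the exponent at
  once.\<close>

lemma powr_bounds:
  fixes a b x s :: real
  assumes "0 < a" "a \<le> x" "x \<le> b"
  shows "min (a powr s) (b powr s) \<le> x powr s" "x powr s \<le> max (a powr s) (b powr s)"
proof -
  consider "0 \<le> s" | "s \<le> 0" by linarith
  then have "(a powr s \<le> x powr s \<and> x powr s \<le> b powr s) \<or> (b powr s \<le> x powr s \<and> x powr s \<le> a powr s)"
  proof cases
    case 1 then show ?thesis using assms by (intro disjI1 conjI powr_mono2) auto
  next
    case 2 then show ?thesis using assms by (intro disjI2 conjI powr_mono2') auto
  qed
  then show "min (a powr s) (b powr s) \<le> x powr s" "x powr s \<le> max (a powr s) (b powr s)" by auto
qed

text \<open>The source of the exponent \<open>\<bar>s\<bar>\<close> in the comparison of the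
  densities.\<close>

lemma min_powr_eq:
  fixes m M s :: real
  assumes "0 < m" "m \<le> M"
  shows "(M / m) powr (- \<bar>s\<bar>) * max (m powr s) (M powr s) = min (m powr s) (M powr s)"
proof (cases "0 \<le> s")
  case True
  then have "m powr s \<le> M powr s" using assms by (intro powr_mono2) auto
  then show ?thesis using True assms by (simp add: powr_divide powr_minus field_simps)
next
  case False
  then have "M powr s \<le> m powr s" using assms by (intro powr_mono2') auto
  then show ?thesis using False assms by (simp add: powr_divide)
qed

section \<open>Measurability and norm estimates for matrices\<close>

lemma mv_measurable [measurable]:
  fixes f :: "'a \<Rightarrow> real ^ 'n ^ 'n" and h :: "'a \<Rightarrow> real ^ 'n"
  assumes "f \<in> borel_measurable M" "h \<in> borel_measurable M"
  shows "(\<lambda>x. f x *v h x) \<in> borel_measurable M"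
proof (rule borel_measurable_continuous_Pair[OF assms])
  have "bilinear (\<lambda>(g :: real ^ 'n ^ 'n) v. g *v v)"
    by (auto simp: bilinear_def intro!: linearI simp: matrix_vector_mult_add_rdistrib matrix_vector_right_distrib
        scaleR_matrix_vector_assoc matrix_vector_mult_scaleR)
  then have "bounded_bilinear (\<lambda>(g :: real ^ 'n ^ 'n) v. g *v v)" by (simp add: bilinear_conv_bounded_bilinear)
  then show "continuous_on UNIV (\<lambda>x :: (real ^ 'n ^ 'n) \<times> (real ^ 'n). fst x *v snd x)"
    by (rule bounded_bilinear.continuous_on) (intro continuous_intros)+
qed

lemma l1norm_measurable [measurable]: "l1norm \<in> borel_measurable borel"
  unfolding l1norm_def by (intro borel_measurable_continuous_onI continuous_intros)

lemma act_measurable [measurable]: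
  fixes f :: "'a \<Rightarrow> real ^ 'n ^ 'n" and h :: "'a \<Rightarrow> real ^ 'n"
  assumes [measurable]: "f \<in> borel_measurable M" "h \<in> borel_measurable M"
  shows "(\<lambda>x. act (f x) (h x)) \<in> borel_measurable M"
  unfolding act_def by measurable

lemma transpose_measurable [measurable]:
  "(transpose :: real ^ 'n ^ 'n \<Rightarrow> _) \<in> borel_measurable borel"
proof (rule borel_measurable_continuous_onI)
  have "linear (transpose :: real ^ 'n ^ 'n \<Rightarrow> _)"
    by (intro linearI) (simp_all add: transpose_def vec_eq_iff)
  then show "continuous_on UNIV (transpose :: real ^ 'n ^ 'n \<Rightarrow> _)"
    by (intro linear_continuous_on) (simp add: linear_conv_bounded_linear)
qed

lemma SSeps_borel [measurable]: "SSeps \<epsilon> \<in> sets borel"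
  by (simp add: closed_SSeps borel_closed)

lemma l1norm_mv_le:
  assumes g: "\<And>i j. 0 \<le> g $ i $ j" and v: "v \<in> SS"
  shows "l1norm (g *v v) \<le> mnorm g"
proof -
  have "\<bar>(g *v v) $ i\<bar> \<le> (\<Sum>j\<in>UNIV. g $ i $ j)" for i
  proof -
    have "\<bar>(g *v v) $ i\<bar> = (\<Sum>j\<in>UNIV. g $ i $ j * v $ j)"
      using g v by (simp add: matrix_vector_mult_def SS_nonneg sum_nonneg)
    also have "\<dots> \<le> (\<Sum>j\<in>UNIV. g $ i $ j * 1)"
      using g v by (intro sum_mono mult_left_mono) (auto simp: SS_le_1)
    finally show ?thesis by simp
  qed
  then show ?thesis unfolding l1norm_def mnorm_def by (intro sum_mono) auto
qed

text \<open>Each row sum is averaged with the weights \<open>v $ l\<close>, and each entry is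
  compared with the one in column \<open>l\<close> of the same row. For negative exponents this
  lower bound on \<open>l1norm (g *v v)\<close> becomes an upper bound on its power.\<close>

lemma mnorm_le_l1norm_mv:
  fixes g :: "real ^ 'n ^ 'n"
  assumes g: "\<And>i j. 0 \<le> g $ i $ j" and k: "\<And>i j k l. g $ i $ j \<le> C * g $ k $ l" and C: "0 \<le> C" and v: "v \<in> SS"
  shows "mnorm g \<le> C * real CARD('n) * l1norm (g *v v)"
proof -
  have "(\<Sum>j\<in>UNIV. g $ i $ j) \<le> C * real CARD('n) * \<bar>(g *v v) $ i\<bar>" for i
  proof -
    have "(\<Sum>j\<in>UNIV. g $ i $ j) = (\<Sum>j\<in>UNIV. \<Sum>l\<in>UNIV. v $ l * g $ i $ j)"
      using sum_l1norm[OF v] by (simp flip: sum_distrib_right)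
    also have "\<dots> \<le> (\<Sum>j\<in>(UNIV :: 'n set). \<Sum>l\<in>UNIV. v $ l * (C * g $ i $ l))"
      using k v SS_nonneg by (intro sum_mono mult_left_mono) auto
    also have "\<dots> = C * real CARD('n) * (g *v v) $ i"
      by (simp add: matrix_vector_mult_def sum_distrib_left algebra_simps)
    also have "\<dots> \<le> C * real CARD('n) * \<bar>(g *v v) $ i\<bar>" using C by (intro mult_left_mono) auto
    finally show ?thesis .
  qed
  then show ?thesis unfolding l1norm_def mnorm_def by (subst sum_distrib_left) (intro sum_mono)
qed

lemma mnorm_transpose: "mnorm (transpose g) = mnorm g"
  unfolding mnorm_def transpose_def by (subst sum.swap) simp

text \<open>The two sign cases differ in how powers of the norms are dominated by the integrable
  \<open>mnorm g powr s\<close>; with the domination assumed, the arguments in the locale treat both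
  signs alike.\<close>

locale positive_matrices =
  fixes \<mu> :: "(real ^ 'n ^ 'n) measure" and \<nu> \<nu>' :: "(real ^ 'n) measure" and \<epsilon> s \<gamma> K :: real
  assumes mu: "prob_on GG \<mu>" and nu: "prob_on SS \<nu>" and nu': "prob_on SS \<nu>'"
    and eps: "0 < \<epsilon>" "\<epsilon> < 1" and s: "s \<noteq> 0" and gamma: "0 < \<gamma>" "\<gamma> \<le> 1"
    and pos: "AE g in \<mu>. pos_mat g"
    and act_SSeps: "AE g in \<mu>. \<forall>v\<in>SS. act g v \<in> SSeps \<epsilon>"
    and moment: "integrable \<mu> (\<lambda>g. mnorm g powr s)"
    and K: "AE g in \<mu>. \<forall>v\<in>SS. l1norm (g *v v) powr s \<le> K * mnorm g powr s"
    and K_transpose: "AE g in \<mu>. \<forall>v\<in>SS. l1norm (transpose g *v v) powr s \<le> K * mnorm g powr s"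
    and eigen: "eigenmeasure (Ps \<mu> s) (kappa \<mu> s) \<nu>"
    and eigen': "eigenmeasure (Ps_star \<mu> s) (kappa \<mu> s) \<nu>'"
begin

abbreviation "R \<equiv> rs \<nu>' s"
abbreviation "\<kappa> \<equiv> kappa \<mu> s"

sublocale mu: prob_space \<mu> using mu by (simp add: prob_on_def)
sublocale nu: prob_space \<nu> using nu by (simp add: prob_on_def)
sublocale nu': prob_space \<nu>' using nu' by (simp add: prob_on_def)

lemma id_measurable [measurable]:
  "(\<lambda>g. g) \<in> borel_measurable \<mu>" "(\<lambda>v. v) \<in> borel_measurable \<nu>" "(\<lambda>v. v) \<in> borel_measurable \<nu>'"
  using mu nu nu' unfolding prob_on_def
  by (auto cong: measurable_cong_sets intro: measurable_restrict_space1)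

lemma space_nu: "space \<nu> = SS" "space \<nu>' = SS"
  using nu nu' sets_eq_imp_space_eq[of \<nu>] sets_eq_imp_space_eq[of \<nu>'] by (auto simp: prob_on_def space_restrict_space)

lemma R_bounds:
  assumes a: "0 < a" and w: "\<And>u. u \<in> SS \<Longrightarrow> a \<le> w \<bullet> u \<and> w \<bullet> u \<le> b"
  shows "integrable \<nu>' (\<lambda>u. (w \<bullet> u) powr s)"
    and "min (a powr s) (b powr s) \<le> R w" "R w \<le> max (a powr s) (b powr s)"
proof -
  have b: "min (a powr s) (b powr s) \<le> (w \<bullet> u) powr s" "(w \<bullet> u) powr s \<le> max (a powr s) (b powr s)"
    if "u \<in> space \<nu>'" for u
    using powr_bounds[OF a] w that by (auto simp: space_nu)
  show i: "integrable \<nu>' (\<lambda>u. (w \<bullet> u) powr s)"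
    using b by (intro nu'.integrable_const_bound[of _ "max (a powr s) (b powr s)"] AE_I2) auto
  have "(LINT u|\<nu>'. min (a powr s) (b powr s)) \<le> R w" unfolding rs_def
    using b by (intro integral_mono i) auto
  then show "min (a powr s) (b powr s) \<le> R w" by (simp add: nu'.prob_space)
  have "R w \<le> (LINT u|\<nu>'. max (a powr s) (b powr s))" unfolding rs_def
    using b by (intro integral_mono i) auto
  then show "R w \<le> max (a powr s) (b powr s)" by (simp add: nu'.prob_space)
qed

lemma R_pos:
  fixes w :: "real ^ 'n"
  assumes w: "\<And>i. 0 < w $ i"
  shows "integrable \<nu>' (\<lambda>u. (w \<bullet> u) powr s)" "0 < R w"
proof -
  define a b where "a = Min (range (($) w))" and "b = (\<Sum>i\<in>UNIV. w $ i)"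
  have "a \<in> range (($) w)" unfolding a_def by (intro Min_in) auto
  then have a: "0 < a" using w by auto
  have b: "0 < b" unfolding b_def using w by (intro sum_pos) auto
  have bd: "a \<le> w \<bullet> u \<and> w \<bullet> u \<le> b" if u: "u \<in> SS" for u
  proof
    have "a = (\<Sum>i\<in>UNIV. a * u $ i)" using sum_l1norm[OF u] by (simp flip: sum_distrib_left)
    also have "\<dots> \<le> w \<bullet> u" unfolding inner_vec_def inner_real_def a_def
      using SS_nonneg[OF u] by (intro sum_mono mult_right_mono) auto
    finally show "a \<le> w \<bullet> u" .
    have "w \<bullet> u \<le> (\<Sum>i\<in>UNIV. w $ i * 1)" unfolding inner_vec_def inner_real_def
      using SS_le_1[OF u] w by (intro sum_mono mult_left_mono) (auto simp: less_imp_le)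
    then show "w \<bullet> u \<le> b" by (simp add: b_def)
  qed
  show "integrable \<nu>' (\<lambda>u. (w \<bullet> u) powr s)" by (rule R_bounds(1)[OF a bd])
  have "0 < min (a powr s) (b powr s)" using a b by simp
  also have "\<dots> \<le> R w" by (rule R_bounds(2)[OF a bd])
  finally show "0 < R w" .
qed

text \<open>For \<open>v\<close> in \<open>SSeps \<epsilon>\<close> and \<open>u\<close> in
  \<open>SS\<close> the product \<open>v \<bullet> u\<close> lies between \<open>\<epsilon>\<close>
  and 1, so this bounds its power for either sign of \<open>s\<close>.\<close>

definition Rmax :: real where "Rmax = max (\<epsilon> powr s) 1"

lemma R_SSeps: "v \<in> SSeps \<epsilon> \<Longrightarrow> 0 < R v" "v \<in> SSeps \<epsilon> \<Longrightarrow> R v \<le> Rmax"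
  using R_pos(2)[of v] SSeps_pos[OF eps, of v] R_bounds(3)[OF eps(1), of v 1] SSeps_inner[of v \<epsilon>]
    inner_le_1[of v] SSeps_in_SS[of v \<epsilon>]
  by (auto simp: inner_commute Rmax_def)

lemma R_scale:
  assumes "0 \<le> t" "\<And>i. 0 < w $ i" shows "R (t *\<^sub>R w) = t powr s * R w"
proof -
  have "R (t *\<^sub>R w) = (LINT u|\<nu>'. t powr s * (w \<bullet> u) powr s)" unfolding rs_def
    using assms inner_pos[OF assms(2)] by (intro Bochner_Integration.integral_cong refl) (auto simp: powr_mult space_nu less_imp_le)
  then show ?thesis by (simp add: rs_def)
qed

text \<open>The comparison of vectors passes to inner products with every \<open>u\<close> in
  \<open>SS\<close>, then to their powers, then to the integral.\<close>

lemma R_compare: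
  assumes w: "\<And>i. 0 < w $ i" "\<And>i. 0 < w' $ i" and m: "0 < m"
    and le: "\<And>i. m * w' $ i \<le> w $ i" "\<And>i. w $ i \<le> M * w' $ i"
  shows "min (m powr s) (M powr s) * R w' \<le> R w" "R w \<le> max (m powr s) (M powr s) * R w'"
proof -
  have *: "min (m powr s) (M powr s) * (w' \<bullet> u) powr s \<le> (w \<bullet> u) powr s \<and>
        (w \<bullet> u) powr s \<le> max (m powr s) (M powr s) * (w' \<bullet> u) powr s" if "u \<in> space \<nu>'" for u
  proof -
    have u: "u \<in> SS" using that by (simp add: space_nu)
    have p: "0 < w' \<bullet> u" by (rule inner_pos[OF w(2) u])
    have "m * (w' \<bullet> u) \<le> w \<bullet> u" "w \<bullet> u \<le> M * (w' \<bullet> u)"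
      unfolding inner_vec_def inner_real_def sum_distrib_left using le SS_nonneg[OF u]
      by (auto intro!: sum_mono mult_right_mono simp flip: mult.assoc)
    then have y: "m \<le> (w \<bullet> u) / (w' \<bullet> u)" "(w \<bullet> u) / (w' \<bullet> u) \<le> M" using p by (auto simp: field_simps)
    have "(w \<bullet> u) powr s = ((w \<bullet> u) / (w' \<bullet> u)) powr s * (w' \<bullet> u) powr s"
      using p y m by (simp add: powr_mult[symmetric])
    then show ?thesis using powr_bounds[OF m y, of s] by (auto intro: mult_right_mono)
  qed
  have "(LINT u|\<nu>'. min (m powr s) (M powr s) * (w' \<bullet> u) powr s) \<le> R w" unfolding rs_def
    using * by (intro integral_mono integrable_mult_right R_pos(1) w) auto
  then show "min (m powr s) (M powr s) * R w' \<le> R w" by (simp add: rs_def)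
  have "R w \<le> (LINT u|\<nu>'. max (m powr s) (M powr s) * (w' \<bullet> u) powr s)" unfolding rs_def
    using * by (intro integral_mono integrable_mult_right R_pos(1) w) auto
  then show "R w \<le> max (m powr s) (M powr s) * R w'" by (simp add: rs_def)
qed

lemma R_measurable [measurable]: "R \<in> borel_measurable borel"
  unfolding rs_def[abs_def] by (rule nu'.borel_measurable_lebesgue_integral) measurable

lemma good: "AE g in \<mu>. pos_mat g \<and> (\<forall>v\<in>SS. act g v \<in> SSeps \<epsilon>)"
  using pos act_SSeps by eventually_elim auto

text \<open>Since \<open>(g *v v) \<bullet> u\<close> equals
  \<open>v \<bullet> (transpose g *v u)\<close>, Fubini turns the integral into that of
  \<open>Ps_star\<close> applied to \<open>(v \<bullet> u) powr s\<close> against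
  \<open>\<nu>'\<close>, where the eigenvalue equation applies. \<open>K_transpose\<close> and
  \<open>moment\<close> give the integrability.\<close>

lemma R_eigen:
  assumes v: "v \<in> SSeps \<epsilon>"
  shows "integrable \<mu> (\<lambda>g. R (g *v v))" "(LINT g|\<mu>. R (g *v v)) = \<kappa> * R v"
proof -
  define h where "h g u = ((g *v v) \<bullet> u) powr s" for g :: "real ^ 'n ^ 'n" and u
  have vp: "0 < v $ i" for i by (rule SSeps_pos[OF eps v])
  note vS = SSeps_in_SS[OF v]
  have h_eq: "h g u = l1norm (transpose g *v u) powr s * (v \<bullet> act (transpose g) u) powr s"
    and act_in: "act (transpose g) u \<in> SS" if g: "pos_mat g" and u: "u \<in> SS" for g u
  proof -
    have gt: "pos_mat (transpose g)" using g by (simp add: pos_mat_def transpose_def)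
    have "(g *v v) \<bullet> u = (transpose g *v u) \<bullet> v"
      by (metis dot_lmul_matrix inner_commute transpose_matrix_vector)
    also have "\<dots> = l1norm (transpose g *v u) * (v \<bullet> act (transpose g) u)"
      by (subst act_scale[OF gt u, symmetric]) (simp add: inner_commute)
    finally have e: "(g *v v) \<bullet> u = l1norm (transpose g *v u) * (v \<bullet> act (transpose g) u)" .
    have l: "0 < l1norm (transpose g *v u)" by (rule pos_mat_l1norm[OF gt u])
    show a: "act (transpose g) u \<in> SS"
      using l pos_mat_vec_pos[OF gt u]
      by (auto simp: SS_def act_def l1norm_def abs_mult less_imp_le simp flip: sum_distrib_left sum_divide_distrib)
    show "h g u = l1norm (transpose g *v u) powr s * (v \<bullet> act (transpose g) u) powr s"
      unfolding h_def e using l inner_pos[OF vp a] by (simp add: powr_mult less_imp_le)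
  qed
  have h_le: "AE g in \<mu>. \<forall>u\<in>SS. h g u \<le> Rmax * K * mnorm g powr s"
    using pos K_transpose
  proof eventually_elim
    case (elim g)
    show ?case
    proof
      fix u :: "real ^ 'n" assume u: "u \<in> SS"
      have "\<epsilon> \<le> v \<bullet> act (transpose g) u" "v \<bullet> act (transpose g) u \<le> 1"
        using SSeps_inner[OF v act_in[OF elim(1) u]] inner_le_1[OF vS act_in[OF elim(1) u]] by (simp_all add: inner_commute)
      then have "(v \<bullet> act (transpose g) u) powr s \<le> Rmax" using powr_bounds(2)[OF eps(1), of _ 1 s] by (simp add: Rmax_def)
      then have "h g u \<le> (K * mnorm g powr s) * Rmax" unfolding h_eq[OF elim(1) u]
        using elim u by (intro mult_mono) (auto intro: order_trans[OF powr_ge_zero])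
      then show "h g u \<le> Rmax * K * mnorm g powr s" by (simp add: mult_ac)
    qed
  qed
  have Rh: "R (g *v v) = (LINT u|\<nu>'. h g u)" for g by (simp add: rs_def h_def)
  have hi: "AE g in \<mu>. integrable \<nu>' (h g)"
    using pos by eventually_elim (unfold h_def[abs_def], intro R_pos pos_mat_vec_pos vS)
  show Ri: "integrable \<mu> (\<lambda>g. R (g *v v))"
  proof (rule Bochner_Integration.integrable_bound)
    show "integrable \<mu> (\<lambda>g. Rmax * K * mnorm g powr s)" using moment by simp
    show "AE g in \<mu>. norm (R (g *v v)) \<le> norm (Rmax * K * mnorm g powr s)"
      using h_le hi
    proof eventually_elim
      case (elim g)
      have "(LINT u|\<nu>'. h g u) \<le> (LINT u|\<nu>'. Rmax * K * mnorm g powr s)"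
        using elim by (intro integral_mono) (auto simp: space_nu)
      moreover have "0 \<le> (LINT u|\<nu>'. h g u)" by (intro integral_nonneg_AE AE_I2) (simp add: h_def)
      ultimately show ?case unfolding Rh by (simp add: nu'.prob_space)
    qed
  qed measurable
  interpret pair_sigma_finite \<mu> \<nu>' ..
  have h_meas [measurable]: "case_prod h \<in> borel_measurable (\<mu> \<Otimes>\<^sub>M \<nu>')" unfolding h_def by measurable
  have hint: "integrable (\<mu> \<Otimes>\<^sub>M \<nu>') (case_prod h)"
  proof (rule Fubini_integrable)
    show "integrable \<mu> (\<lambda>g. LINT u|\<nu>'. norm (case_prod h (g, u)))"
      using Ri by (simp add: Rh h_def)
    show "AE g in \<mu>. integrable \<nu>' (\<lambda>u. case_prod h (g, u))" using hi by simp
  qed measurable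
  have star: "Ps_star \<mu> s (\<lambda>u. complex_of_real ((v \<bullet> u) powr s)) u = complex_of_real (LINT g|\<mu>. h g u)"
    if u: "u \<in> SS" for u
  proof -
    have "(LINT g|\<mu>. h g u) = (LINT g|\<mu>. l1norm (transpose g *v u) powr s * (v \<bullet> act (transpose g) u) powr s)"
    proof (rule integral_cong_AE)
      show "AE g in \<mu>. h g u = l1norm (transpose g *v u) powr s * (v \<bullet> act (transpose g) u) powr s"
        using pos by eventually_elim (simp add: h_eq u)
    qed (unfold h_def, measurable)
    then show ?thesis by (simp add: Ps_star_def scaleR_conv_of_real flip: of_real_mult integral_complex_of_real)
  qed
  \<comment> \<open>The coordinates of \<open>v\<close> are strictly positive, so
    \<open>v \<bullet> u\<close> has no zero on \<open>SS\<close> and even negative powers of it are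
    continuous there.\<close>
  have "continuous_on SS (\<lambda>u. complex_of_real ((v \<bullet> u) powr s))"
    using inner_pos[OF vp] by (intro continuous_intros) force
  with eigen' have "(LINT u|\<nu>'. Ps_star \<mu> s (\<lambda>u. complex_of_real ((v \<bullet> u) powr s)) u)
      = \<kappa> *\<^sub>R (LINT u|\<nu>'. complex_of_real ((v \<bullet> u) powr s))" by (simp add: eigenmeasure_def)
  also have "(LINT u|\<nu>'. Ps_star \<mu> s (\<lambda>u. complex_of_real ((v \<bullet> u) powr s)) u)
      = (LINT u|\<nu>'. complex_of_real (LINT g|\<mu>. h g u))"
    using star by (intro Bochner_Integration.integral_cong) (auto simp: space_nu)
  finally have "complex_of_real (LINT u|\<nu>'. LINT g|\<mu>. h g u) = complex_of_real (\<kappa> * R v)"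
    by (simp add: rs_def scaleR_conv_of_real)
  then have "(LINT u|\<nu>'. LINT g|\<mu>. h g u) = \<kappa> * R v" by (simp only: of_real_eq_iff)
  then show "(LINT g|\<mu>. R (g *v v)) = \<kappa> * R v" unfolding Rh using Fubini_integral[OF hint] by simp
qed

lemma SSeps_nonempty: "SSeps \<epsilon> \<noteq> ({} :: (real ^ 'n) set)"
proof -
  obtain v where "v \<in> space \<nu>" using nu.not_empty by blast
  then have v: "v \<in> SS" by (simp add: space_nu)
  have "AE g in \<mu>. SSeps \<epsilon> \<noteq> ({} :: (real ^ 'n) set)" using act_SSeps by eventually_elim (use v in auto)
  then show ?thesis by simp
qed

text \<open>Read off from the eigenvalue equation, whose other factors are positive; the limit that
  defines \<open>kappa\<close> is not evaluated.\<close>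

lemma kappa_pos: "0 < \<kappa>"
proof -
  obtain v :: "real ^ 'n" where v: "v \<in> SSeps \<epsilon>" using SSeps_nonempty by blast
  have "AE g in \<mu>. 0 < R (g *v v)"
    using pos by eventually_elim (intro R_pos pos_mat_vec_pos SSeps_in_SS[OF v])
  then have "0 < (LINT g|\<mu>. R (g *v v))" using R_eigen(1)[OF v] mu.expectation_greater by blast
  then show ?thesis using R_eigen(2)[OF v] R_SSeps(1)[OF v] by (simp add: zero_less_mult_iff)
qed

text \<open>The continuous function \<open>\<psi>\<close> is non-negative and vanishes on
  \<open>SS\<close> exactly at the points of \<open>SSeps \<epsilon>\<close>. As the action ends
  there, \<open>Ps\<close> annihilates \<open>\<psi>\<close>, and the eigenvalue equation with
  positive \<open>\<kappa>\<close> makes its integral vanish.\<close>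

lemma nu_SSeps: "AE v in \<nu>. v \<in> SSeps \<epsilon>"
proof -
  define \<psi> where "\<psi> v = (\<Sum>i\<in>UNIV. max 0 (\<epsilon> - v $ i))" for v :: "real ^ 'n"
  have cont: "continuous_on UNIV \<psi>" unfolding \<psi>_def by (intro continuous_intros)
  have "Ps \<mu> s (\<lambda>v. complex_of_real (\<psi> v)) v = 0" if v: "v \<in> SS" for v
    unfolding Ps_def
  proof (rule integral_eq_zero_AE)
    show "AE g in \<mu>. l1norm (g *v v) powr s *\<^sub>R complex_of_real (\<psi> (act g v)) = 0"
      using act_SSeps
    proof eventually_elim
      case (elim g)
      then have "act g v \<in> SSeps \<epsilon>" using v by blast
      then have "\<psi> (act g v) = 0" unfolding \<psi>_def SSeps_iff by (intro sum.neutral) auto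
      then show ?case by simp
    qed
  qed
  then have "(LINT v|\<nu>. Ps \<mu> s (\<lambda>v. complex_of_real (\<psi> v)) v) = (LINT v|\<nu>. 0)"
    by (intro Bochner_Integration.integral_cong) (auto simp: space_nu)
  moreover have "continuous_on SS (\<lambda>v. complex_of_real (\<psi> v))"
    using cont by (intro continuous_intros) (auto intro: continuous_on_subset)
  ultimately have "\<kappa> *\<^sub>R (LINT v|\<nu>. complex_of_real (\<psi> v)) = 0"
    using eigen by (simp add: eigenmeasure_def)
  then have 0: "(LINT v|\<nu>. \<psi> v) = 0" using kappa_pos by simp
  have nn: "0 \<le> \<psi> v" for v unfolding \<psi>_def by (intro sum_nonneg) auto
  have [measurable]: "\<psi> \<in> borel_measurable borel" using cont by (rule borel_measurable_continuous_onI)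
  have "\<psi> v \<le> (\<Sum>i\<in>(UNIV :: 'n set). \<epsilon>)" if "v \<in> SS" for v
    unfolding \<psi>_def using SS_nonneg[OF that] eps by (intro sum_mono) auto
  then have "integrable \<nu> \<psi>"
    using nn by (intro nu.integrable_const_bound[of _ "\<Sum>i\<in>(UNIV :: 'n set). \<epsilon>"] AE_I2) (auto simp: space_nu)
  then have "AE v in \<nu>. \<psi> v = 0" using 0 nn by (subst integral_nonneg_eq_0_iff_AE[symmetric]) auto
  moreover have "AE v in \<nu>. v \<in> SS" using space_nu by auto
  ultimately show ?thesis
  proof eventually_elim
    case (elim v)
    then have "\<forall>i\<in>UNIV. max 0 (\<epsilon> - v $ i) = 0" unfolding \<psi>_def by (subst (asm) sum_nonneg_eq_0_iff) auto
    then have "\<epsilon> \<le> v $ i" for i by (metis UNIV_I diff_le_0_iff_le max.cobounded2)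
    then show ?case using elim by (simp add: SSeps_iff)
  qed
qed

end

lemma indicator_measurable:
  fixes \<phi> :: "real ^ 'n \<Rightarrow> complex"
  assumes "continuous_on (SSeps \<epsilon>) \<phi>"
  shows "(\<lambda>v. indicator (SSeps \<epsilon>) v *\<^sub>R \<phi> v) \<in> borel_measurable borel"
  using assms by (intro borel_measurable_continuous_on_indicator) auto

text \<open>Most identities between operators hold on \<open>SSeps \<epsilon>\<close> only. The
  indicators in \<open>Psf\<close> and \<open>nusf\<close> turn agreement there into equality of the
  images as total functions, which is what inductions on iterates need.\<close>

lemma Psf_cong: "(\<And>v. v \<in> SSeps \<epsilon> \<Longrightarrow> \<phi> v = \<psi> v) \<Longrightarrow> Psf \<mu> \<epsilon> s f \<phi> = Psf \<mu> \<epsilon> s f \<psi>"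
  by (auto simp: fun_eq_iff Psf_def set_lebesgue_integral_def indicator_def intro!: Bochner_Integration.integral_cong)

lemma nusf_cong: "(\<And>v. v \<in> SSeps \<epsilon> \<Longrightarrow> \<phi> v = \<psi> v) \<Longrightarrow> nusf \<nu> \<nu>' \<epsilon> s f \<phi> = nusf \<nu> \<nu>' \<epsilon> s f \<psi>"
  unfolding nusf_def set_lebesgue_integral_def
  by (intro arg_cong[where f = "\<lambda>x. x /\<^sub>R _"] Bochner_Integration.integral_cong) (auto simp: indicator_def)

lemma Psf_scaleR: "Psf \<mu> \<epsilon> s f (\<lambda>v. c *\<^sub>R \<phi> v) v = c *\<^sub>R Psf \<mu> \<epsilon> s f \<phi> v"
  by (simp add: Psf_def set_lebesgue_integral_def mult_ac flip: integral_scaleR_right)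

lemma nusf_scaleR: "nusf \<nu> \<nu>' \<epsilon> s f (\<lambda>v. c *\<^sub>R \<phi> v) = c *\<^sub>R nusf \<nu> \<nu>' \<epsilon> s f \<phi>"
  by (simp add: nusf_def set_lebesgue_integral_def mult_ac flip: integral_scaleR_right)

lemma Lsf_cong:
  "(\<And>v. v \<in> SSeps \<epsilon> \<Longrightarrow> \<phi> v = \<psi> v) \<Longrightarrow> Lsf \<mu> \<nu> \<nu>' \<epsilon> s f \<phi> = Lsf \<mu> \<nu> \<nu>' \<epsilon> s f \<psi>"
  using Psf_cong[of \<epsilon> \<phi> \<psi> \<mu> s f] nusf_cong[of \<epsilon> \<phi> \<psi> \<nu> \<nu>' s f]
  by (simp add: fun_eq_iff Lsf_def Msf_def)

lemma Lsf_scaleR: "Lsf \<mu> \<nu> \<nu>' \<epsilon> s f (\<lambda>v. c *\<^sub>R \<phi> v) v = c *\<^sub>R Lsf \<mu> \<nu> \<nu>' \<epsilon> s f \<phi> v"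
  by (simp add: Lsf_def Msf_def Psf_scaleR nusf_scaleR scaleR_diff_right mult_ac)

lemma Nsf_cong:
  assumes "\<And>v. v \<in> SSeps \<epsilon> \<Longrightarrow> \<phi> v = \<psi> v"
  shows "Nsf \<mu> \<nu> \<nu>' \<epsilon> s f \<phi> = Nsf \<mu> \<nu> \<nu>' \<epsilon> s f \<psi>"
proof -
  have "Lsf \<mu> \<nu> \<nu>' \<epsilon> s f (\<lambda>u. rsf \<nu>' s f u *\<^sub>R \<phi> u) = Lsf \<mu> \<nu> \<nu>' \<epsilon> s f (\<lambda>u. rsf \<nu>' s f u *\<^sub>R \<psi> u)"
    using assms by (intro Lsf_cong) simp
  then show ?thesis by (simp add: fun_eq_iff Nsf_def)
qed

lemma Qsf_cong:
  assumes "\<And>v. v \<in> SSeps \<epsilon> \<Longrightarrow> \<phi> v = \<psi> v"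
  shows "Qsf \<mu> \<nu>' \<epsilon> s f \<phi> = Qsf \<mu> \<nu>' \<epsilon> s f \<psi>"
proof -
  have "Psf \<mu> \<epsilon> s f (\<lambda>u. rsf \<nu>' s f u *\<^sub>R \<phi> u) = Psf \<mu> \<epsilon> s f (\<lambda>u. rsf \<nu>' s f u *\<^sub>R \<psi> u)"
    using assms by (intro Psf_cong) simp
  then show ?thesis by (simp add: fun_eq_iff Qsf_def)
qed

section \<open>The normalised kernel and its stationary mean\<close>

context positive_matrices
begin

definition q :: "real ^ 'n \<Rightarrow> real ^ 'n ^ 'n \<Rightarrow> real" where
  "q v g = R (g *v v) / (\<kappa> * R v)"

abbreviation "hoelder \<equiv> osc_holder (SSeps \<epsilon> :: (real ^ 'n) set) ratio_dist \<gamma>"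

lemma hoelder_continuous: "hoelder \<phi> A B \<Longrightarrow> continuous_on (SSeps \<epsilon>) \<phi>"
  by (rule osc_holder_imp_continuous[OF eps gamma(1)])

sublocale contracting_kernel \<mu> "SSeps \<epsilon> :: (real ^ 'n) set" act q ratio_dist "1 - \<epsilon>" "\<bar>s\<bar>" "1 / \<epsilon>\<^sup>2" \<gamma>
proof
  show "0 < 1 - \<epsilon>" "1 - \<epsilon> < 1" "0 < \<bar>s\<bar>" "0 < \<gamma>" "\<gamma> \<le> 1" using eps s gamma by auto
  show "1 \<le> 1 / \<epsilon>\<^sup>2" using eps by (simp add: power_le_one)
  fix u v :: "real ^ 'n" assume v: "v \<in> SSeps \<epsilon>"
  note vS = SSeps_in_SS[OF v]
  show "integrable \<mu> (q v)" unfolding q_def[abs_def] using R_eigen(1)[OF v] by simp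
  show "(LINT g|\<mu>. q v g) = 1"
    using R_eigen(2)[OF v] R_SSeps(1)[OF v] kappa_pos by (simp add: q_def)
  show "AE g in \<mu>. 0 \<le> q v g" using pos
  proof eventually_elim
    case (elim g)
    then show ?case using R_pos(2)[OF pos_mat_vec_pos[OF elim vS]] R_SSeps(1)[OF v] kappa_pos by (simp add: q_def)
  qed
  show "AE g in \<mu>. act g v \<in> SSeps \<epsilon>" using act_SSeps vS by (auto elim!: eventually_mono)
  show "(\<lambda>g. indicat_real (SSeps \<epsilon>) (act g v) *\<^sub>R \<phi> (act g v)) \<in> borel_measurable \<mu>"
    if "hoelder \<phi> A B" for \<phi> A B
    by (rule measurable_compose[OF _ indicator_measurable[OF hoelder_continuous[OF that]]]) measurable
  assume u: "u \<in> SSeps \<epsilon>"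
  show "0 \<le> ratio_dist u v" "ratio_dist u v \<le> 1 / \<epsilon>\<^sup>2"
    using ratio_dist_nonneg[OF eps u v] ratio_dist_le[OF eps u v] by auto
  show "AE g in \<mu>. ratio_dist (act g u) (act g v) \<le> (1 - \<epsilon>) * ratio_dist u v"
    using good by eventually_elim (auto intro: ratio_dist_act[OF eps _ _ u v])
  note up = SSeps_pos[OF eps u] and vp = SSeps_pos[OF eps v]
  define m M where "m = mcr u v" and "M = 1 / mcr v u"
  have mv: "0 < mcr u v" "0 < mcr v u" by (auto intro: mcr_pos up vp)
  have m: "0 < m" and mle: "m * v $ i \<le> u $ i" for i using mv by (auto simp: m_def intro: mcr_le up vp)
  have Mle: "u $ i \<le> M * v $ i" for i using mcr_le[of v u i] mv up vp by (simp add: M_def field_simps)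
  \<comment> \<open>Any coordinate will do; \<open>undefined\<close> merely names one.\<close>
  have "m * v $ undefined \<le> M * v $ undefined" using mle Mle order_trans by blast
  then have mM: "m \<le> M" using vp by simp
  have ratio: "1 + ratio_dist u v = M / m" by (simp add: ratio_dist_def m_def M_def)
  have Ru: "R u \<le> max (m powr s) (M powr s) * R v" by (rule R_compare(2)[OF up vp m mle Mle])
  show "AE g in \<mu>. (1 + ratio_dist u v) powr - \<bar>s\<bar> * q v g \<le> q u g" using pos
  proof eventually_elim
    case (elim g)
    note gu = pos_mat_vec_pos[OF elim SSeps_in_SS[OF u]] and gv = pos_mat_vec_pos[OF elim vS]
    have "m * (g *v v) $ i \<le> (g *v u) $ i \<and> (g *v u) $ i \<le> M * (g *v v) $ i" for i
      unfolding matrix_vector_mult_def vec_lambda_beta sum_distrib_left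
      using elim mle Mle by (auto intro!: sum_mono mult_left_mono simp: mult.left_commute[of _ "g $ _ $ _"] pos_mat_def less_imp_le)
    then have Rg: "min (m powr s) (M powr s) * R (g *v v) \<le> R (g *v u)"
      by (intro R_compare(1)[OF gu gv m]) auto
    note p = R_pos(2)[OF gv] R_SSeps(1)[OF v] R_SSeps(1)[OF u] kappa_pos
    \<comment> \<open>The numerators \<open>R (g *v u)\<close> and \<open>R (g *v v)\<close>
      contribute the minimum, the normalisations \<open>R u\<close> and \<open>R v\<close> the
      maximum; their quotient is \<open>(M / m) powr - \<bar>s\<bar>\<close>.\<close>
    have "(M / m) powr - \<bar>s\<bar> * R (g *v v) * R u \<le> (M / m) powr - \<bar>s\<bar> * R (g *v v) * (max (m powr s) (M powr s) * R v)"
      using Ru p by (intro mult_left_mono) auto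
    also have "\<dots> = min (m powr s) (M powr s) * R (g *v v) * R v"
      unfolding min_powr_eq[OF m mM, symmetric] by (simp add: mult_ac)
    also have "\<dots> \<le> R (g *v u) * R v" using Rg p by (intro mult_right_mono) auto
    finally show ?case unfolding ratio q_def using p by (simp add: field_simps)
  qed
qed

text \<open>\<open>Z\<close> is the normalisation in \<open>nusf\<close>, \<open>wt\<close> the
  density of the stationary law with respect to \<open>\<nu>\<close>, and \<open>stat\<close> the
  functional \<open>pisf\<close> after cancellation of \<open>f\<close>.\<close>

definition Z :: real where "Z = (LINT v|\<nu>. R v)"
definition wt :: "real ^ 'n \<Rightarrow> real" where "wt v = indicator (SSeps \<epsilon>) v * R v / Z"
definition stat :: "(real ^ 'n \<Rightarrow> complex) \<Rightarrow> complex" where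
  "stat \<phi> = (LINT v|\<nu>. wt v *\<^sub>R (indicator (SSeps \<epsilon>) v *\<^sub>R \<phi> v))"

lemma R_integrable: "integrable \<nu> R"
  using nu_SSeps R_SSeps
  by (intro nu.integrable_const_bound[of _ Rmax]) (auto elim!: eventually_mono simp: less_imp_le)

lemma Z_pos: "0 < Z"
  unfolding Z_def using R_integrable nu_SSeps R_SSeps(1)
  by (intro nu.expectation_greater) (auto elim!: eventually_mono)

lemma wt: "integrable \<nu> wt" "AE v in \<nu>. 0 \<le> wt v" "(LINT v|\<nu>. wt v) = 1"
proof -
  have eq: "AE v in \<nu>. wt v = R v / Z" using nu_SSeps by eventually_elim (simp add: wt_def)
  have [measurable]: "wt \<in> borel_measurable \<nu>" unfolding wt_def[abs_def] by measurable
  have RZ: "integrable \<nu> (\<lambda>v. R v / Z)" using R_integrable by simp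
  show "integrable \<nu> wt" by (rule integrable_cong_AE_imp[OF RZ]) (use eq in \<open>auto elim!: eventually_mono\<close>)
  show "AE v in \<nu>. 0 \<le> wt v" using Z_pos R_SSeps(1) by (intro AE_I2) (auto simp: wt_def indicator_def less_imp_le)
  have "(LINT v|\<nu>. wt v) = (LINT v|\<nu>. R v / Z)" by (intro integral_cong_AE eq) auto
  then show "(LINT v|\<nu>. wt v) = 1" using Z_pos by (simp add: Z_def)
qed

lemma stat_integrable:
  assumes \<phi>: "hoelder \<phi> A B"
  shows "integrable \<nu> (\<lambda>v. wt v *\<^sub>R (indicator (SSeps \<epsilon>) v *\<^sub>R \<phi> v))"
proof -
  obtain y :: "real ^ 'n" where y: "y \<in> SSeps \<epsilon>" using SSeps_nonempty by blast
  have [measurable]: "(\<lambda>v. indicator (SSeps \<epsilon>) v *\<^sub>R \<phi> v) \<in> borel_measurable \<nu>"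
    by (rule measurable_compose[OF _ indicator_measurable[OF hoelder_continuous[OF \<phi>]]]) measurable
  show ?thesis
  proof (rule Bochner_Integration.integrable_bound)
    show "integrable \<nu> (\<lambda>v. wt v * (cmod (\<phi> y) + A))" using wt(1) by simp
    show "AE v in \<nu>. norm (wt v *\<^sub>R (indicator (SSeps \<epsilon>) v *\<^sub>R \<phi> v)) \<le> norm (wt v * (cmod (\<phi> y) + A))"
      using nu_SSeps
    proof eventually_elim
      case (elim v)
      have "cmod (\<phi> v) \<le> cmod (\<phi> y) + cmod (\<phi> v - \<phi> y)" by (metis add.commute diff_add_cancel norm_triangle_ineq)
      also have "cmod (\<phi> v - \<phi> y) \<le> A" by (rule osc_holder_osc[OF \<phi> elim y])
      finally have "cmod (\<phi> v) \<le> \<bar>cmod (\<phi> y) + A\<bar>" by simp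
      then show ?case using elim by (auto simp: abs_mult intro!: mult_left_mono)
    qed
    show "(\<lambda>v. wt v *\<^sub>R (indicat_real (SSeps \<epsilon>) v *\<^sub>R \<phi> v)) \<in> borel_measurable \<nu>"
      using wt(1) by (intro borel_measurable_scaleR[where f = wt]) auto
  qed
qed

text \<open>Converts decay of the oscillation of \<open>Q ^^ n\<close> into decay of the sup norm of
  its distance from the stationary mean.\<close>

lemma stat_osc:
  assumes \<phi>: "hoelder \<phi> A B" and y: "y \<in> SSeps \<epsilon>"
  shows "cmod (stat \<phi> - \<phi> y) \<le> A"
proof -
  have "AE v in \<nu>. cmod (indicator (SSeps \<epsilon>) v *\<^sub>R \<phi> v - \<phi> y) \<le> A"
    using nu_SSeps by eventually_elim (simp add: osc_holder_osc[OF \<phi> _ y])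
  from weighted_average_bound[OF wt(1,2) stat_integrable[OF \<phi>] this]
  show ?thesis by (simp add: stat_def wt(3))
qed

lemma stat_cong: "(\<And>v. v \<in> SSeps \<epsilon> \<Longrightarrow> \<phi> v = \<psi> v) \<Longrightarrow> stat \<phi> = stat \<psi>"
  unfolding stat_def by (intro Bochner_Integration.integral_cong) (auto simp: indicator_def)

lemma stat_diff_const:
  assumes \<phi>: "hoelder \<phi> A B"
  shows "stat (\<lambda>v. \<phi> v - c) = stat \<phi> - c"
proof -
  have c: "hoelder (\<lambda>_. c) 0 0" by (simp add: osc_holder_def)
  have "stat (\<lambda>v. \<phi> v - c) = stat \<phi> - stat (\<lambda>_. c)"
    using stat_integrable[OF \<phi>] stat_integrable[OF c] by (simp add: stat_def scaleR_diff_right)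
  moreover obtain y :: "real ^ 'n" where "y \<in> SSeps \<epsilon>" using SSeps_nonempty by blast
  ultimately show ?thesis using stat_osc[OF c] by simp
qed

lemma R_continuous: "continuous_on (SSeps \<epsilon>) R"
proof -
  have one: "R v - R u \<le> Rmax * (\<bar>s\<bar> * ratio_dist u v)"
    if u: "u \<in> SSeps \<epsilon>" and v: "v \<in> SSeps \<epsilon>" for u v :: "real ^ 'n"
  proof -
    note up = SSeps_pos[OF eps u] and vp = SSeps_pos[OF eps v]
    define m M where "m = mcr u v" and "M = 1 / mcr v u"
    have mv: "0 < mcr u v" "0 < mcr v u" by (auto intro: mcr_pos up vp)
    have m: "0 < m" and mle: "m * v $ i \<le> u $ i" for i using mv by (auto simp: m_def intro: mcr_le up vp)
    have Mle: "u $ i \<le> M * v $ i" for i using mcr_le[of v u i] mv up vp by (simp add: M_def field_simps)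
    have m1: "m \<le> 1" "1 \<le> M"
      using mcr_SSeps_le_1[OF eps u v] mcr_SSeps_le_1[OF eps v u] mv by (auto simp: m_def M_def)
    have ratio: "1 + ratio_dist u v = M / m" by (simp add: ratio_dist_def m_def M_def)
    \<comment> \<open>Equal coordinate sums put 1 between \<open>m\<close> and \<open>M\<close>.
      Hence the maximum is at least 1 and, by \<open>min_powr_eq\<close>, the minimum at least
      \<open>(M / m) powr - \<bar>s\<bar>\<close>.\<close>
    have "1 \<le> max (m powr s) (M powr s)" using powr_bounds(2)[OF m m1, of s] by simp
    then have "(M / m) powr - \<bar>s\<bar> * 1 \<le> (M / m) powr - \<bar>s\<bar> * max (m powr s) (M powr s)"
      by (intro mult_left_mono) auto
    then have "(1 + ratio_dist u v) powr - \<bar>s\<bar> \<le> min (m powr s) (M powr s)"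
      using min_powr_eq[OF m] m1 ratio by simp
    then have "(1 + ratio_dist u v) powr - \<bar>s\<bar> * R v \<le> min (m powr s) (M powr s) * R v"
      using R_SSeps(1)[OF v] by (intro mult_right_mono) auto
    also have "\<dots> \<le> R u" by (rule R_compare(1)[OF up vp m mle Mle])
    finally have "R v - R u \<le> (1 - (1 + ratio_dist u v) powr - \<bar>s\<bar>) * R v" by (simp add: algebra_simps)
    also have "\<dots> \<le> (\<bar>s\<bar> * ratio_dist u v) * Rmax"
      using one_minus_powr_le[of "ratio_dist u v" "\<bar>s\<bar>"] ratio_dist_nonneg[OF eps u v] R_SSeps[OF v]
      by (intro mult_mono) auto
    finally show ?thesis by (simp add: mult_ac)
  qed
  have sym: "ratio_dist u v = ratio_dist v u" for u v :: "real ^ 'n" by (simp add: ratio_dist_def mult.commute)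
  have "osc_holder (SSeps \<epsilon>) ratio_dist 1 (\<lambda>v. complex_of_real (R v)) (Rmax * \<bar>s\<bar> * (1 / \<epsilon>\<^sup>2)) (Rmax * \<bar>s\<bar>)"
    unfolding osc_holder_def
  proof (intro ballI conjI)
    fix u v :: "real ^ 'n" assume uv: "u \<in> SSeps \<epsilon>" "v \<in> SSeps \<epsilon>"
    have "\<bar>R u - R v\<bar> \<le> Rmax * \<bar>s\<bar> * ratio_dist u v"
      using one[OF uv] one[OF uv(2,1)] by (auto simp: sym[of v u] abs_le_iff mult.assoc)
    then have b: "cmod (complex_of_real (R u) - complex_of_real (R v)) \<le> Rmax * \<bar>s\<bar> * ratio_dist u v"
      by (simp flip: of_real_diff)
    then show "cmod (complex_of_real (R u) - complex_of_real (R v)) \<le> Rmax * \<bar>s\<bar> * ratio_dist u v powr 1"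
      using ratio_dist_nonneg[OF eps uv] by simp
    have "Rmax * \<bar>s\<bar> * ratio_dist u v \<le> Rmax * \<bar>s\<bar> * (1 / \<epsilon>\<^sup>2)"
      using ratio_dist_le[OF eps uv] by (intro mult_left_mono) (auto simp: Rmax_def)
    then show "cmod (complex_of_real (R u) - complex_of_real (R v)) \<le> Rmax * \<bar>s\<bar> * (1 / \<epsilon>\<^sup>2)" using b by linarith
  qed
  then have "continuous_on (SSeps \<epsilon>) (\<lambda>v. Re (complex_of_real (R v)))"
    by (intro continuous_on_Re osc_holder_imp_continuous[OF eps zero_less_one])
  then show ?thesis by simp
qed

text \<open>By homogeneity of \<open>R\<close>, applying \<open>Ps\<close> to \<open>R\<close> times
  \<open>\<phi>\<close> gives \<open>\<kappa> * R\<close> times \<open>Q \<phi>\<close>; integration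
  against the eigenmeasure \<open>\<nu>\<close> then removes \<open>\<kappa>\<close>.\<close>

lemma stat_Q:
  assumes \<phi>: "hoelder \<phi> A B"
  shows "stat (Q \<phi>) = stat \<phi>"
proof -
  have A: "0 \<le> A" using osc_holder_osc[OF \<phi>] SSeps_nonempty norm_ge_zero order_trans by blast
  have Q\<phi>: "hoelder (Q \<phi>) A ((1 - \<epsilon>) powr \<gamma> * \<bar>B\<bar> + \<bar>s\<bar> * (1 / \<epsilon>\<^sup>2) * A)"
    by (rule Q_osc_holder[OF osc_holder_mono[OF \<phi>]]) auto
  \<comment> \<open>\<open>eigenmeasure\<close> admits only functions continuous on all of
    \<open>SS\<close>, hence the Tietze extension. Which extension is taken is immaterial: almost
    every \<open>g\<close> maps \<open>SS\<close> into \<open>SSeps \<epsilon>\<close>, and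
    \<open>\<nu>\<close> is carried by that set.\<close>
  have "continuous_on (SSeps \<epsilon>) (\<lambda>v. R v *\<^sub>R \<phi> v)"
    by (intro continuous_on_scaleR R_continuous hoelder_continuous[OF \<phi>])
  moreover have "closedin (top_of_set UNIV) (SSeps \<epsilon> :: (real ^ 'n) set)" by (simp add: closed_SSeps)
  ultimately obtain \<psi> :: "real ^ 'n \<Rightarrow> complex" where \<psi>: "continuous_on UNIV \<psi>"
    and \<psi>_eq: "\<And>v. v \<in> SSeps \<epsilon> \<Longrightarrow> \<psi> v = R v *\<^sub>R \<phi> v"
    by (rule Tietze_unbounded) blast
  have [measurable]: "\<psi> \<in> borel_measurable borel" using \<psi> by (rule borel_measurable_continuous_onI)
  have Ps_eq: "Ps \<mu> s \<psi> v = (\<kappa> * R v) *\<^sub>R Q \<phi> v" if v: "v \<in> SSeps \<epsilon>" for v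
  proof -
    note vS = SSeps_in_SS[OF v]
    let ?h = "\<lambda>g. indicat_real (SSeps \<epsilon>) (act g v) *\<^sub>R \<phi> (act g v)"
    note [measurable] = measurable[OF \<phi> v]
    have "Ps \<mu> s \<psi> v = (LINT g|\<mu>. R (g *v v) *\<^sub>R ?h g)" unfolding Ps_def
    proof (rule integral_cong_AE)
      show "AE g in \<mu>. l1norm (g *v v) powr s *\<^sub>R \<psi> (act g v) = R (g *v v) *\<^sub>R ?h g"
        using good
      proof eventually_elim
        case (elim g)
        have a: "act g v \<in> SSeps \<epsilon>" using elim vS by blast
        have "R (g *v v) = l1norm (g *v v) powr s * R (act g v)"
          by (subst act_scale[symmetric]) (use elim vS SSeps_pos[OF eps a] pos_mat_l1norm[of g v] in \<open>auto simp: R_scale\<close>)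
        then show ?case using a by (simp add: \<psi>_eq)
      qed
    qed measurable
    also have "\<dots> = (LINT g|\<mu>. (\<kappa> * R v) *\<^sub>R (q v g *\<^sub>R ?h g))"
      using kappa_pos R_SSeps(1)[OF v] by (simp add: q_def)
    finally show ?thesis by (simp only: Q_def integral_scaleR_right)
  qed
  have [measurable]: "(\<lambda>v. indicator (SSeps \<epsilon>) v *\<^sub>R \<phi> v) \<in> borel_measurable borel"
      "(\<lambda>v. indicator (SSeps \<epsilon>) v *\<^sub>R Q \<phi> v) \<in> borel_measurable borel"
    by (intro indicator_measurable hoelder_continuous[OF \<phi>] hoelder_continuous[OF Q\<phi>])+
  have [measurable]: "wt \<in> borel_measurable \<nu>" using wt(1) by auto
  have "continuous_on SS \<psi>" using \<psi> by (rule continuous_on_subset) simp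
  with eigen have e: "(LINT v|\<nu>. Ps \<mu> s \<psi> v) = \<kappa> *\<^sub>R (LINT v|\<nu>. \<psi> v)" by (simp add: eigenmeasure_def)
  have 1: "(LINT v|\<nu>. Ps \<mu> s \<psi> v) = (LINT v|\<nu>. (\<kappa> * Z) *\<^sub>R (wt v *\<^sub>R (indicator (SSeps \<epsilon>) v *\<^sub>R Q \<phi> v)))"
  proof (rule integral_cong_AE)
    show "AE v in \<nu>. Ps \<mu> s \<psi> v = (\<kappa> * Z) *\<^sub>R (wt v *\<^sub>R (indicator (SSeps \<epsilon>) v *\<^sub>R Q \<phi> v))"
      using nu_SSeps by eventually_elim (use Z_pos in \<open>simp add: Ps_eq wt_def\<close>)
    show "Ps \<mu> s \<psi> \<in> borel_measurable \<nu>" unfolding Ps_def[abs_def]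
      by (rule mu.borel_measurable_lebesgue_integral) measurable
  qed measurable
  have 2: "(LINT v|\<nu>. \<psi> v) = (LINT v|\<nu>. Z *\<^sub>R (wt v *\<^sub>R (indicator (SSeps \<epsilon>) v *\<^sub>R \<phi> v)))"
  proof (rule integral_cong_AE)
    show "AE v in \<nu>. \<psi> v = Z *\<^sub>R (wt v *\<^sub>R (indicator (SSeps \<epsilon>) v *\<^sub>R \<phi> v))"
      using nu_SSeps by eventually_elim (use Z_pos in \<open>simp add: \<psi>_eq wt_def\<close>)
  qed measurable
  have "(\<kappa> * Z) *\<^sub>R stat (Q \<phi>) = \<kappa> *\<^sub>R (Z *\<^sub>R stat \<phi>)"
    using e unfolding 1 2 stat_def integral_scaleR_right .
  then show ?thesis using kappa_pos Z_pos by simp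
qed

lemma Q_funpow_hoelder:
  assumes \<phi>: "hoelder \<phi> A B"
  shows "\<exists>A' B'. hoelder ((Q ^^ n) \<phi>) A' B'"
proof -
  have "hoelder \<phi> \<bar>A\<bar> \<bar>B\<bar>" by (rule osc_holder_mono[OF \<phi>]) auto
  from Q_funpow_osc_holder[OF this] show ?thesis by auto
qed

lemma stat_Q_funpow:
  assumes \<phi>: "hoelder \<phi> A B"
  shows "stat ((Q ^^ n) \<phi>) = stat \<phi>"
proof (induction n)
  case (Suc n)
  then show ?case using Q_funpow_hoelder[OF \<phi>, of n] stat_Q by auto
qed simp

section \<open>Elimination of \<open>f\<close> and powers of \<open>Nsf\<close>\<close>

context
  fixes f :: "real ^ 'n"
  assumes f: "f \<in> SS"
begin

lemma f_inner_pos: "v \<in> SSeps \<epsilon> \<Longrightarrow> 0 < f \<bullet> v"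
  using SSeps_inner[of v \<epsilon> f] f eps by simp

lemma rsf_pos: "v \<in> SSeps \<epsilon> \<Longrightarrow> 0 < rsf \<nu>' s f v"
  using f_inner_pos[of v] R_SSeps(1)[of v] by (simp add: rsf_def)

text \<open>In \<open>rsf\<close> at \<open>act g v\<close> the power of
  \<open>f \<bullet> act g v\<close> reduces \<open>(f \<bullet> (g *v v)) powr s\<close> to
  \<open>l1norm (g *v v) powr s\<close>, which together with \<open>R (act g v)\<close> recombines
  to \<open>R (g *v v)\<close>.\<close>

lemma Qsf_eq_Q:
  assumes \<phi>: "hoelder \<phi> A B" and v: "v \<in> SSeps \<epsilon>"
  shows "Qsf \<mu> \<nu>' \<epsilon> s f \<phi> v = Q \<phi> v"
proof -
  note [measurable] = measurable[OF \<phi> v]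
  let ?c = "1 / (\<kappa> * rsf \<nu>' s f v)"
  let ?h = "\<lambda>g. indicat_real (SSeps \<epsilon>) (act g v) *\<^sub>R \<phi> (act g v)"
  have "Qsf \<mu> \<nu>' \<epsilon> s f \<phi> v =
      (LINT g|\<mu>. (?c * ((f \<bullet> (g *v v)) powr s / (f \<bullet> v) powr s) * rsf \<nu>' s f (act g v)) *\<^sub>R ?h g)"
    unfolding Qsf_def Psf_def set_lebesgue_integral_def integral_scaleR_right[symmetric]
    by (intro Bochner_Integration.integral_cong refl) (simp add: indicator_def)
  also have "\<dots> = Q \<phi> v" unfolding Q_def
  proof (rule integral_cong_AE)
    show "AE g in \<mu>. (?c * ((f \<bullet> (g *v v)) powr s / (f \<bullet> v) powr s) * rsf \<nu>' s f (act g v)) *\<^sub>R ?h g = q v g *\<^sub>R ?h g"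
      using good
    proof eventually_elim
      case (elim g)
      let ?l = "l1norm (g *v v)"
      have vS: "v \<in> SS" by (rule SSeps_in_SS[OF v])
      have a: "act g v \<in> SSeps \<epsilon>" using elim vS by blast
      have l: "0 < ?l" using elim vS by (simp add: pos_mat_l1norm)
      have gv: "g *v v = ?l *\<^sub>R act g v" using elim vS by (simp add: act_scale)
      have fa: "0 < f \<bullet> act g v" by (rule f_inner_pos[OF a])
      have "(f \<bullet> (g *v v)) powr s = ?l powr s * (f \<bullet> act g v) powr s"
        by (subst gv) (use l fa in \<open>simp add: powr_mult\<close>)
      moreover have "R (g *v v) = ?l powr s * R (act g v)"
        by (subst gv) (use l SSeps_pos[OF eps a] in \<open>simp add: R_scale\<close>)
      ultimately have "?c * ((f \<bullet> (g *v v)) powr s / (f \<bullet> v) powr s) * rsf \<nu>' s f (act g v) = q v g"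
        using fa f_inner_pos[OF v] by (simp add: rsf_def q_def powr_minus field_simps)
      then show ?case by simp
    qed
    show "(\<lambda>g. q v g *\<^sub>R ?h g) \<in> borel_measurable \<mu>" unfolding q_def by measurable
  qed (unfold rsf_def, measurable)
  finally show ?thesis .
qed

lemma pisf_eq_stat: "pisf \<nu> \<nu>' \<epsilon> s f \<phi> = stat \<phi>"
proof -
  have "pisf \<nu> \<nu>' \<epsilon> s f \<phi> = (1 / Z) *\<^sub>R (LINT v|\<nu>. (indicator (SSeps \<epsilon>) v * R v) *\<^sub>R (indicator (SSeps \<epsilon>) v *\<^sub>R \<phi> v))"
    unfolding pisf_def nusf_def set_lebesgue_integral_def Z_def
    using f_inner_pos
    by (auto intro!: arg_cong[where f = "\<lambda>x. x /\<^sub>R _"] Bochner_Integration.integral_cong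
        simp: indicator_def rsf_def powr_minus inverse_eq_divide[symmetric] less_imp_neq[THEN not_sym] simp flip: mult.assoc)
  also have "\<dots> = stat \<phi>" unfolding stat_def wt_def integral_scaleR_right[symmetric] by simp
  finally show ?thesis .
qed

text \<open>The shift by \<open>c\<close> is included because each iterate of \<open>Nsf\<close> is
  one of \<open>Q\<close> minus a constant; \<open>c = 0\<close> is the splitting of
  \<open>Q\<close> itself.\<close>

lemma Nsf_diff_const:
  assumes \<phi>: "hoelder \<phi> A B" and v: "v \<in> SSeps \<epsilon>"
  shows "Nsf \<mu> \<nu> \<nu>' \<epsilon> s f (\<lambda>u. \<phi> u - c) v = Q \<phi> v - stat \<phi>"
proof -
  have h: "hoelder (\<lambda>u. \<phi> u - c) A B" using \<phi> by (simp add: osc_holder_def)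
  have "Nsf \<mu> \<nu> \<nu>' \<epsilon> s f (\<lambda>u. \<phi> u - c) v = Qsf \<mu> \<nu>' \<epsilon> s f (\<lambda>u. \<phi> u - c) v - pisf \<nu> \<nu>' \<epsilon> s f (\<lambda>u. \<phi> u - c)"
    using rsf_pos[OF v] kappa_pos by (simp add: Nsf_def Lsf_def Msf_def Qsf_def pisf_def scaleR_diff_right)
  then show ?thesis
    by (simp add: Qsf_eq_Q[OF h v] pisf_eq_stat Q_diff_const[OF \<phi> v] stat_diff_const[OF \<phi>])
qed

context
  fixes \<phi> A B
  assumes \<phi>: "hoelder \<phi> A B"
begin

lemma Qsf_funpow: "v \<in> SSeps \<epsilon> \<Longrightarrow> (Qsf \<mu> \<nu>' \<epsilon> s f ^^ n) \<phi> v = (Q ^^ n) \<phi> v"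
proof (induction n arbitrary: v)
  case (Suc n)
  have "Qsf \<mu> \<nu>' \<epsilon> s f ((Qsf \<mu> \<nu>' \<epsilon> s f ^^ n) \<phi>) v = Qsf \<mu> \<nu>' \<epsilon> s f ((Q ^^ n) \<phi>) v"
    using Suc.IH by (simp cong: Qsf_cong)
  then show ?case using Q_funpow_hoelder[OF \<phi>, of n] Qsf_eq_Q Suc.prems by auto
qed simp

text \<open>Stated for \<open>Suc n\<close>, since the zeroth power is the identity and does not
  subtract the mean.\<close>

lemma Nsf_funpow:
  "v \<in> SSeps \<epsilon> \<Longrightarrow> (Nsf \<mu> \<nu> \<nu>' \<epsilon> s f ^^ Suc n) \<phi> v = (Q ^^ Suc n) \<phi> v - stat \<phi>"
proof (induction n arbitrary: v)
  case 0
  then show ?case using Nsf_diff_const[OF \<phi>, of v 0] by simp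
next
  case (Suc n)
  have "Nsf \<mu> \<nu> \<nu>' \<epsilon> s f ((Nsf \<mu> \<nu> \<nu>' \<epsilon> s f ^^ Suc n) \<phi>)
      = Nsf \<mu> \<nu> \<nu>' \<epsilon> s f (\<lambda>u. (Q ^^ Suc n) \<phi> u - stat \<phi>)"
    by (rule Nsf_cong) (rule Suc.IH)
  moreover obtain A' B' where "hoelder ((Q ^^ Suc n) \<phi>) A' B'" using Q_funpow_hoelder[OF \<phi>] by blast
  ultimately show ?case using Nsf_diff_const Suc.prems stat_Q_funpow[OF \<phi>, of "Suc n"] by simp
qed

lemma Pisf_Nsf: "pisf \<nu> \<nu>' \<epsilon> s f (Nsf \<mu> \<nu> \<nu>' \<epsilon> s f \<phi>) = 0"
proof -
  have "stat (Nsf \<mu> \<nu> \<nu>' \<epsilon> s f \<phi>) = stat (\<lambda>v. Q \<phi> v - stat \<phi>)"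
    using Nsf_diff_const[OF \<phi>, of _ 0] by (intro stat_cong) simp
  also have "\<dots> = 0" using Q_funpow_hoelder[OF \<phi>, of 1] stat_diff_const stat_Q[OF \<phi>] by auto
  finally show ?thesis by (simp add: pisf_eq_stat)
qed

end

lemma Nsf_const: "v \<in> SSeps \<epsilon> \<Longrightarrow> Nsf \<mu> \<nu> \<nu>' \<epsilon> s f (\<lambda>_. c) v = 0"
  using Nsf_diff_const[of "\<lambda>_. 0" 0 0 v "- c"] by (simp add: osc_holder_def Q_def stat_def)

text \<open>\<open>Nsf\<close> is \<open>Lsf\<close> conjugated by multiplication with
  \<open>rsf\<close> and divided by \<open>\<kappa>\<close>. Conjugation passes to powers, and
  \<open>Lsf_scaleR\<close> extracts the scalars.\<close>

lemma Lsf_funpow: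
  "v \<in> SSeps \<epsilon> \<Longrightarrow> (Lsf \<mu> \<nu> \<nu>' \<epsilon> s f ^^ n) (\<lambda>u. rsf \<nu>' s f u *\<^sub>R \<phi> u) v
     = (\<kappa> ^ n * rsf \<nu>' s f v) *\<^sub>R (Nsf \<mu> \<nu> \<nu>' \<epsilon> s f ^^ n) \<phi> v"
proof (induction n arbitrary: v)
  case (Suc n)
  let ?N = "Nsf \<mu> \<nu> \<nu>' \<epsilon> s f" and ?L = "Lsf \<mu> \<nu> \<nu>' \<epsilon> s f"
  have "?L ((?L ^^ n) (\<lambda>u. rsf \<nu>' s f u *\<^sub>R \<phi> u)) = ?L (\<lambda>u. \<kappa> ^ n *\<^sub>R (rsf \<nu>' s f u *\<^sub>R (?N ^^ n) \<phi> u))"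
    by (rule Lsf_cong) (simp add: Suc.IH)
  then have "(?L ^^ Suc n) (\<lambda>u. rsf \<nu>' s f u *\<^sub>R \<phi> u) v = \<kappa> ^ n *\<^sub>R ?L (\<lambda>u. rsf \<nu>' s f u *\<^sub>R (?N ^^ n) \<phi> u) v"
    by (simp only: funpow.simps comp_apply Lsf_scaleR)
  also have "?L (\<lambda>u. rsf \<nu>' s f u *\<^sub>R (?N ^^ n) \<phi> u) v = (\<kappa> * rsf \<nu>' s f v) *\<^sub>R ?N ((?N ^^ n) \<phi>) v"
    using rsf_pos[OF Suc.prems] kappa_pos by (simp add: Nsf_def)
  finally show ?case by (simp add: mult_ac)
qed simp

end

lemma Bspace_hoelder:
  assumes "\<phi> \<in> Bspace \<epsilon> \<gamma>"
  obtains b where "0 \<le> b" "Bnorm \<epsilon> \<gamma> \<phi> = ennreal b" "hoelder \<phi> (2 * b) b"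
proof
  show 1: "Bnorm \<epsilon> \<gamma> \<phi> = ennreal (enn2real (Bnorm \<epsilon> \<gamma> \<phi>))" using assms by (simp add: Bspace_def)
  show 2: "0 \<le> enn2real (Bnorm \<epsilon> \<gamma> \<phi>)" by simp
  show "hoelder \<phi> (2 * enn2real (Bnorm \<epsilon> \<gamma> \<phi>)) (enn2real (Bnorm \<epsilon> \<gamma> \<phi>))"
    using 1 2 gamma by (intro Bnorm_imp_osc_holder[OF eps]) auto
qed

lemma Nsf_spectral_gap:
  "\<exists>c a. c > 0 \<and> 0 < a \<and> a < 1 \<and> (\<forall>f\<in>SS. \<forall>n\<ge>1. \<forall>\<phi>\<in>Bspace \<epsilon> \<gamma>.
      Bnorm \<epsilon> \<gamma> ((Nsf \<mu> \<nu> \<nu>' \<epsilon> s f ^^ n) \<phi>) \<le> ennreal (c * a ^ n) * Bnorm \<epsilon> \<gamma> \<phi> \<and>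
      (Nsf \<mu> \<nu> \<nu>' \<epsilon> s f ^^ n) \<phi> \<in> Bspace \<epsilon> \<gamma>)"
proof -
  obtain C a where C: "0 < C" and a: "0 < a" "a < 1"
    and gap: "\<And>\<phi> A B n. hoelder \<phi> A B \<Longrightarrow> 0 \<le> A \<Longrightarrow> 0 \<le> B \<Longrightarrow>
       hoelder ((Q ^^ n) \<phi>) (C * a ^ n * (A + B)) (C * a ^ n * (A + B))"
    using spectral_gap by blast
  \<comment> \<open>The 3 is the sum of the bounds \<open>2 * b\<close> and \<open>b\<close> for a
    function of norm \<open>b\<close>; the last factor collects the sup norm and the return to
    \<open>hdist\<close>. As \<open>C\<close> and \<open>a\<close> come from \<open>Q\<close>, they
    are fixed before \<open>f\<close>.\<close>
  define c where "c = 3 * C * (1 + (2 / \<epsilon>\<^sup>2) powr \<gamma>)"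
  have c: "0 < c" using C by (auto simp: c_def intro!: mult_pos_pos add_pos_nonneg)
  have "Bnorm \<epsilon> \<gamma> ((Nsf \<mu> \<nu> \<nu>' \<epsilon> s f ^^ n) \<phi>) \<le> ennreal (c * a ^ n) * Bnorm \<epsilon> \<gamma> \<phi> \<and>
      (Nsf \<mu> \<nu> \<nu>' \<epsilon> s f ^^ n) \<phi> \<in> Bspace \<epsilon> \<gamma>" if f: "f \<in> SS" and n: "n \<ge> 1" and \<phi>: "\<phi> \<in> Bspace \<epsilon> \<gamma>" for f n \<phi>
  proof -
    obtain b where b: "0 \<le> b" "Bnorm \<epsilon> \<gamma> \<phi> = ennreal b" "hoelder \<phi> (2 * b) b"
      using Bspace_hoelder[OF \<phi>] by blast
    let ?A = "C * a ^ n * (3 * b)" and ?N = "(Nsf \<mu> \<nu> \<nu>' \<epsilon> s f ^^ n) \<phi>"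
    have A: "0 \<le> ?A" using C a b by simp
    have Qh: "hoelder ((Q ^^ n) \<phi>) ?A ?A" using gap[OF b(3), of n] b(1) by simp
    have N: "?N v = (Q ^^ n) \<phi> v - stat \<phi>" if "v \<in> SSeps \<epsilon>" for v
      using Nsf_funpow[OF f b(3) that, of "n - 1"] n by simp
    have Nh: "hoelder ?N ?A ?A" using Qh N by (simp add: osc_holder_def)
    have "cmod (?N v) \<le> ?A" if "v \<in> SSeps \<epsilon>" for v
      using stat_osc[OF Qh that] stat_Q_funpow[OF b(3), of n] by (simp add: N[OF that] norm_minus_commute)
    then have "Bnorm \<epsilon> \<gamma> ?N \<le> ennreal (?A + ?A * (2 / \<epsilon>\<^sup>2) powr \<gamma>)"
      using A gamma by (intro Bnorm_le[OF eps Nh]) auto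
    also have "?A + ?A * (2 / \<epsilon>\<^sup>2) powr \<gamma> = c * a ^ n * b" by (simp add: c_def algebra_simps)
    also have "ennreal (c * a ^ n * b) = ennreal (c * a ^ n) * Bnorm \<epsilon> \<gamma> \<phi>"
      using c a b by (simp add: ennreal_mult)
    finally have le: "Bnorm \<epsilon> \<gamma> ?N \<le> ennreal (c * a ^ n) * Bnorm \<epsilon> \<gamma> \<phi>" .
    have "ennreal (c * a ^ n) * Bnorm \<epsilon> \<gamma> \<phi> < \<infinity>" unfolding b(2) by (simp add: ennreal_mult_less_top)
    with le have "Bnorm \<epsilon> \<gamma> ?N < \<infinity>" by (rule le_less_trans)
    then have "?N \<in> Bspace \<epsilon> \<gamma>" using hoelder_continuous[OF Nh] by (simp add: Bspace_def)
    with le show ?thesis by blast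
  qed
  with c a show ?thesis by blast
qed

end

text \<open>For positive \<open>s\<close>, \<open>l1norm (g *v v)\<close> is at most
  \<open>mnorm g\<close> on \<open>SS\<close>. For negative \<open>s\<close>, comparable entries
  bound \<open>mnorm g\<close> by a multiple of \<open>l1norm (g *v v)\<close>, and the power
  reverses the inequality. Both arguments are invariant under transposition.\<close>

lemma l1norm_mv_powr_le:
  fixes \<mu> :: "(real ^ 'n ^ 'n) measure"
  assumes cases:
      "(s < 0 \<and> (\<exists>k0>1. AE g in \<mu>. pos_mat g \<and>
            Max (range (\<lambda>(i, j). g $ i $ j)) \<le> k0 * Min (range (\<lambda>(i, j). g $ i $ j)))) \<or>
       (s > 0 \<and> (AE g in \<mu>. pos_mat g))"
  shows "\<exists>K. (AE g in \<mu>. \<forall>v\<in>SS. l1norm (g *v v) powr s \<le> K * mnorm g powr s) \<and>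
     (AE g in \<mu>. \<forall>v\<in>SS. l1norm (transpose g *v v) powr s \<le> K * mnorm g powr s)"
proof -
  have l1: "0 \<le> l1norm w" for w :: "real ^ 'n" by (simp add: l1norm_def sum_nonneg)
  consider "s < 0" "\<exists>k0>1. AE g in \<mu>. pos_mat g \<and>
            Max (range (\<lambda>(i, j). g $ i $ j)) \<le> k0 * Min (range (\<lambda>(i, j). g $ i $ j))"
    | "s > 0" "AE g in \<mu>. pos_mat g"
    using cases by blast
  then show ?thesis
  proof cases
    case 1
    then obtain k where k: "k > 1" and AE: "AE g in \<mu>. pos_mat g \<and>
            Max (range (\<lambda>(i, j). g $ i $ j)) \<le> k * Min (range (\<lambda>(i, j). g $ i $ j))" by blast
    define C where "C = k * real CARD('n)"
    have C: "0 < C" using k by (simp add: C_def)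
    have *: "l1norm (g *v v) powr s \<le> C powr (- s) * mnorm g powr s"
      if g: "\<And>i j. 0 < g $ i $ j" "\<And>i j l m. g $ i $ j \<le> k * g $ l $ m" and v: "v \<in> SS" for g :: "real ^ 'n ^ 'n" and v
    proof -
      have m: "0 < mnorm g" unfolding mnorm_def using g by (intro sum_pos) auto
      have le: "mnorm g \<le> C * l1norm (g *v v)" unfolding C_def
        using mnorm_le_l1norm_mv[of g k v] g k v by (auto simp: less_imp_le)
      have "(C * l1norm (g *v v)) powr s \<le> mnorm g powr s" using 1 m le by (intro powr_mono2') auto
      then have "C powr s * l1norm (g *v v) powr s \<le> mnorm g powr s" using C l1 by (simp add: powr_mult)
      then show ?thesis using C by (simp add: powr_minus field_simps)
    qed
    have entries: "AE g in \<mu>. (\<forall>i j. 0 < g $ i $ j) \<and> (\<forall>i j l m. g $ i $ j \<le> k * g $ l $ m)"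
      using AE
    proof eventually_elim
      case (elim g)
      have "g $ i $ j \<le> k * g $ l $ m" for i j l m
      proof -
        have "g $ i $ j \<le> Max (range (\<lambda>(i, j). g $ i $ j))" by (intro Max_ge) (auto intro: range_eqI[of _ _ "(i, j)"])
        also have "\<dots> \<le> k * Min (range (\<lambda>(i, j). g $ i $ j))" using elim by simp
        also have "\<dots> \<le> k * g $ l $ m" using k by (intro mult_left_mono Min_le) (auto intro: range_eqI[of _ _ "(l, m)"])
        finally show ?thesis .
      qed
      then show ?case using elim by (simp add: pos_mat_def)
    qed
    have "AE g in \<mu>. \<forall>v\<in>SS. l1norm (g *v v) powr s \<le> C powr (- s) * mnorm g powr s"
      using entries by eventually_elim (use * in blast)
    moreover have "AE g in \<mu>. \<forall>v\<in>SS. l1norm (transpose g *v v) powr s \<le> C powr (- s) * mnorm g powr s"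
      using entries
    proof eventually_elim
      case (elim g)
      then show ?case using *[of "transpose g"] by (auto simp: mnorm_transpose) (simp_all add: transpose_def)
    qed
    ultimately show ?thesis by blast
  next
    case 2
    have *: "l1norm (g *v v) powr s \<le> 1 * mnorm g powr s"
      if "\<And>i j. 0 < g $ i $ j" "v \<in> SS" for g :: "real ^ 'n ^ 'n" and v
      using l1norm_mv_le[of g v] l1 that 2 by (auto intro!: powr_mono2 simp: less_imp_le)
    have "AE g in \<mu>. \<forall>v\<in>SS. l1norm (g *v v) powr s \<le> 1 * mnorm g powr s"
      using 2(2) by eventually_elim (use * in \<open>auto simp: pos_mat_def\<close>)
    moreover have "AE g in \<mu>. \<forall>v\<in>SS. l1norm (transpose g *v v) powr s \<le> 1 * mnorm g powr s"
      using 2(2)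
    proof eventually_elim
      case (elim g)
      then show ?case using *[of "transpose g"] by (auto simp: mnorm_transpose pos_mat_def) (simp_all add: transpose_def)
    qed
    ultimately show ?thesis by blast
  qed
qed

theorem proposition3p4:
  fixes \<mu> :: "(real ^ 'n ^ 'n) measure"
    and \<nu> \<nu>' :: "(real ^ 'n) measure"
    and \<epsilon> s \<gamma> :: real
  assumes dim: "CARD('n) \<ge> 2"
    and mu: "prob_on GG \<mu>"
    and Gamma: "0 \<notin> Gamma_mu \<mu>"
    and s: "s \<in> interior (I_mu \<mu>) - {0}"
    and eps: "0 < \<epsilon>" "\<epsilon> < 1"
    and eps_act: "\<forall>g\<in>msupp \<mu>. \<forall>v\<in>SS. g *v v \<noteq> 0 \<longrightarrow> act g v \<in> SSeps \<epsilon>"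
    and cases:
      "(s < 0 \<and>
        (\<exists>k0>1. AE g in \<mu>. pos_mat g \<and>
            Max (range (\<lambda>(i, j). g $ i $ j)) \<le> k0 * Min (range (\<lambda>(i, j). g $ i $ j))) \<and>
        (\<forall>g\<in>msupp \<mu>. \<forall>v\<in>SS. transpose g *v v \<noteq> 0 \<longrightarrow> act (transpose g) v \<in> SSeps \<epsilon>)) \<or>
       (s > 0 \<and>
        (\<exists>k>1. AE g in \<mu>. pos_mat g \<and>
            (\<forall>j. Max (range (\<lambda>i. g $ i $ j)) \<le> k * Min (range (\<lambda>i. g $ i $ j)))))"
    and nu: "prob_on SS \<nu>" "eigenmeasure (Ps \<mu> s) (kappa \<mu> s) \<nu>"
    and nu': "prob_on SS \<nu>'" "eigenmeasure (Ps_star \<mu> s) (kappa \<mu> s) \<nu>'"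
    and gamma: "0 < \<gamma>" "\<gamma> \<le> min \<bar>s\<bar> 1"
  shows
    "(\<forall>f\<in>SS. \<forall>n\<ge>1. \<forall>\<phi>\<in>Bspace \<epsilon> \<gamma>. \<forall>v\<in>SSeps \<epsilon>.
        (Qsf \<mu> \<nu>' \<epsilon> s f ^^ n) \<phi> v
          = Pisf \<nu> \<nu>' \<epsilon> s f \<phi> v + (Nsf \<mu> \<nu> \<nu>' \<epsilon> s f ^^ n) \<phi> v \<and>
        Pisf \<nu> \<nu>' \<epsilon> s f \<phi> v = pisf \<nu> \<nu>' \<epsilon> s f \<phi> \<and>
        (Nsf \<mu> \<nu> \<nu>' \<epsilon> s f ^^ n) \<phi> v
          = (1 / (kappa \<mu> s ^ n * rsf \<nu>' s f v)) *\<^sub>R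
              (Lsf \<mu> \<nu> \<nu>' \<epsilon> s f ^^ n) (\<lambda>u. rsf \<nu>' s f u *\<^sub>R \<phi> u) v \<and>
        Pisf \<nu> \<nu>' \<epsilon> s f (Nsf \<mu> \<nu> \<nu>' \<epsilon> s f \<phi>) v = 0 \<and>
        Nsf \<mu> \<nu> \<nu>' \<epsilon> s f (Pisf \<nu> \<nu>' \<epsilon> s f \<phi>) v = 0) \<and>
     (\<exists>c a. c > 0 \<and> 0 < a \<and> a < 1 \<and>
        (\<forall>f\<in>SS. \<forall>n\<ge>1.
           (\<forall>\<phi>\<in>Bspace \<epsilon> \<gamma>. (Nsf \<mu> \<nu> \<nu>' \<epsilon> s f ^^ n) \<phi> \<in> Bspace \<epsilon> \<gamma>) \<and>
           Bopnorm \<epsilon> \<gamma> (Nsf \<mu> \<nu> \<nu>' \<epsilon> s f ^^ n) \<le> ennreal (c * a ^ n)))"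
proof -
  have pos: "AE g in \<mu>. pos_mat g" using cases by (auto elim!: eventually_mono)
  obtain K where K: "AE g in \<mu>. \<forall>v\<in>SS. l1norm (g *v v) powr s \<le> K * mnorm g powr s"
      "AE g in \<mu>. \<forall>v\<in>SS. l1norm (transpose g *v v) powr s \<le> K * mnorm g powr s"
    using l1norm_mv_powr_le[of s \<mu>] cases pos by blast
  have "AE g in \<mu>. g \<in> msupp \<mu>" using mu by (intro AE_msupp) (simp add: prob_on_def)
  with pos have act: "AE g in \<mu>. \<forall>v\<in>SS. act g v \<in> SSeps \<epsilon>"
  proof eventually_elim
    case (elim g)
    \<comment> \<open>The hypothesis on \<open>\<epsilon>\<close> is guarded by this inequality,
      which positivity of \<open>g\<close> provides.\<close>
    have "g *v v \<noteq> 0" if "v \<in> SS" for v using pos_mat_vec_pos[OF elim(1) that] by (metis less_irrefl zero_index)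
    then show ?case using eps_act elim by blast
  qed
  have "s \<in> I_mu \<mu>" "s \<noteq> 0" using s interior_subset by auto
  then interpret positive_matrices \<mu> \<nu> \<nu>' \<epsilon> s \<gamma> K
    using mu nu nu' eps gamma pos act K by unfold_locales (auto simp: I_mu_def)
  obtain c a where ca: "c > 0" "0 < a" "a < 1" and gap:
    "\<forall>f\<in>SS. \<forall>n\<ge>1. \<forall>\<phi>\<in>Bspace \<epsilon> \<gamma>.
      Bnorm \<epsilon> \<gamma> ((Nsf \<mu> \<nu> \<nu>' \<epsilon> s f ^^ n) \<phi>) \<le> ennreal (c * a ^ n) * Bnorm \<epsilon> \<gamma> \<phi> \<and>
      (Nsf \<mu> \<nu> \<nu>' \<epsilon> s f ^^ n) \<phi> \<in> Bspace \<epsilon> \<gamma>"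
    using Nsf_spectral_gap by blast
  have "Bopnorm \<epsilon> \<gamma> (Nsf \<mu> \<nu> \<nu>' \<epsilon> s f ^^ n) \<le> ennreal (c * a ^ n)" if "f \<in> SS" "n \<ge> 1" for f n
    unfolding Bopnorm_def
  proof (rule SUP_least, safe)
    fix \<phi> :: "real ^ 'n \<Rightarrow> complex" assume \<phi>: "\<phi> \<in> Bspace \<epsilon> \<gamma>" "Bnorm \<epsilon> \<gamma> \<phi> \<le> 1"
    have "ennreal (c * a ^ n) * Bnorm \<epsilon> \<gamma> \<phi> \<le> ennreal (c * a ^ n) * 1" using \<phi> by (intro mult_left_mono) auto
    then show "Bnorm \<epsilon> \<gamma> ((Nsf \<mu> \<nu> \<nu>' \<epsilon> s f ^^ n) \<phi>) \<le> ennreal (c * a ^ n)"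
      using gap that \<phi>(1) order_trans by fastforce
  qed
  with gap ca have second: "\<exists>c a. c > 0 \<and> 0 < a \<and> a < 1 \<and>
        (\<forall>f\<in>SS. \<forall>n\<ge>1.
           (\<forall>\<phi>\<in>Bspace \<epsilon> \<gamma>. (Nsf \<mu> \<nu> \<nu>' \<epsilon> s f ^^ n) \<phi> \<in> Bspace \<epsilon> \<gamma>) \<and>
           Bopnorm \<epsilon> \<gamma> (Nsf \<mu> \<nu> \<nu>' \<epsilon> s f ^^ n) \<le> ennreal (c * a ^ n))" by blast
  show ?thesis
  proof (intro conjI second ballI allI impI)
    fix f v :: "real ^ 'n" and n and \<phi> :: "real ^ 'n \<Rightarrow> complex"
    assume f: "f \<in> SS" and n: "1 \<le> (n :: nat)" and B: "\<phi> \<in> Bspace \<epsilon> \<gamma>" and v: "v \<in> SSeps \<epsilon>"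
    obtain b where \<phi>: "hoelder \<phi> (2 * b) b" using Bspace_hoelder[OF B] by blast
    show "Pisf \<nu> \<nu>' \<epsilon> s f \<phi> v = pisf \<nu> \<nu>' \<epsilon> s f \<phi>" by (simp add: Pisf_def)
    show "(Qsf \<mu> \<nu>' \<epsilon> s f ^^ n) \<phi> v = Pisf \<nu> \<nu>' \<epsilon> s f \<phi> v + (Nsf \<mu> \<nu> \<nu>' \<epsilon> s f ^^ n) \<phi> v"
      using Nsf_funpow[OF f \<phi> v, of "n - 1"] Qsf_funpow[OF f \<phi> v, of n] n by (simp add: Pisf_def pisf_eq_stat[OF f])
    show "(Nsf \<mu> \<nu> \<nu>' \<epsilon> s f ^^ n) \<phi> v
          = (1 / (kappa \<mu> s ^ n * rsf \<nu>' s f v)) *\<^sub>R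
              (Lsf \<mu> \<nu> \<nu>' \<epsilon> s f ^^ n) (\<lambda>u. rsf \<nu>' s f u *\<^sub>R \<phi> u) v"
      using rsf_pos[OF f v] kappa_pos by (simp add: Lsf_funpow[OF f v])
    show "Pisf \<nu> \<nu>' \<epsilon> s f (Nsf \<mu> \<nu> \<nu>' \<epsilon> s f \<phi>) v = 0" by (simp add: Pisf_def Pisf_Nsf[OF f \<phi>])
    show "Nsf \<mu> \<nu> \<nu>' \<epsilon> s f (Pisf \<nu> \<nu>' \<epsilon> s f \<phi>) v = 0"
      unfolding Pisf_def[abs_def] by (rule Nsf_const[OF f v])
  qed
qed

end
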